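(* Let $f\colon\mathbb{R}^d\to\mathbb{R}$ be locally Lipschitz continuous. Let $\{x_k\}_{k\ge1}$ be generated by the stochastic subgradient method $$x_{k+1}=x_k-\alpha_k(y_k+\xi_k)\quad\text{with}\quad y_k\in\partial f(x_k),$$ where $\{\xi_k\}_{k\ge1}$ is a sequence of random vectors on some probability space. Suppose that: 1. $\alpha_k\ge0$, $\sum_{k=1}^\infty\alpha_k=\infty$, and $\sum_{k=1}^\infty\alpha_k^2<\infty$; 2. almost surely, $\sup_{k\ge1}\|x_k\|<\infty$; 3. with the increasing $\sigma$-fields $\mathcal{F}_k=\sigma(x_j,y_j,\xi_i: j\le k,\ i<k)$, there exists a function $p\colon\mathbb{R}^d\to[0,\infty)$, bounded on bounded sets, so that almost surely, for all $k\in\mathbb{N}$, $\mathbb{E}[\xi_k\mid\mathcal{F}_k]=0$ and $\mathbb{E}[\|\xi_k\|^2\mid\mathcal{F}_k]\le p(x_k)$. Suppose moreover that: (a) (Weak Sard) the set of noncritical values of $f$ is dense in $\mathbb{R}$; (b) (Descent) whenever $z\colon\mathbb{R}_+\to\mathbb{R}^d$ is an absolutely continuous curve satisfying $\dot z(t)\in-\partial f(z(t))$ for a.e. $t\ge0$ and $z(0)$ is not a critical point of $f$, there exists a real $T>0$ satisfying $f(z(T))<\sup_{t\in[0,T]}f(z(t))\le f(z(0))$. Then almost surely, every limit point of the iterates $\{x_k\}_{k\ge1}$ is critical for $f$ and the function values $\{f(x_k)\}_{k\ge1}$ converge.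
   Context: For a locally Lipschitz $f\colon\mathbb{R}^d\to\mathbb{R}$, the Clarke subdifferential is $\partial f(x)=\mathrm{conv}\{\lim_{i\to\infty}\nabla f(x_i): x_i\to x,\ x_i\in\Omega\}$, where $\Omega$ is any full-measure set of points at which $f$ is differentiable. A point $x$ is critical for $f$ if $0\in\partial f(x)$. A real $r$ is a critical value of $f$ if $r=f(x)$ for some critical point $x$, and a noncritical value otherwise. A limit point of a sequence is a limit of some subsequence. Absolutely continuous on $\mathbb{R}_+$ means being the integral of a function integrable on compact intervals. *)

theory Defs
  imports "HOL-Probability.Probability"
begin

definition locally_lipschitz :: "('a::metric_space \<Rightarrow> 'b::metric_space) \<Rightarrow> bool" where
  "locally_lipschitz f \<longleftrightarrow> (\<forall>x. \<exists>U L. open U \<and> x \<in> U \<and> L-lipschitz_on U f)"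

definition full_measure_differentiability_set ::
    "('a::euclidean_space \<Rightarrow> real) \<Rightarrow> 'a set \<Rightarrow> bool" where
  "full_measure_differentiability_set f \<Omega> \<longleftrightarrow>
     (AE u in lebesgue. u \<in> \<Omega>) \<and> (\<forall>u\<in>\<Omega>. f differentiable (at u))"

text \<open>The set \<open>\<Omega>\<close> is an explicit parameter: for locally Lipschitz \<open>f\<close> the resulting set is the same
  for every \<open>\<Omega>\<close> with \<^term>\<open>full_measure_differentiability_set f \<Omega>\<close>, but that is a theorem and
  not part of the definition.  Statements about the Clarke subdifferential are to be
  quantified over all such \<open>\<Omega>\<close>.\<close>

definition clarke_subdifferential ::
    "'a::euclidean_space set \<Rightarrow> ('a \<Rightarrow> real) \<Rightarrow> 'a \<Rightarrow> 'a set" where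
  "clarke_subdifferential \<Omega> f x =
     convex hull {v. \<exists>u g. (\<forall>i::nat. u i \<in> \<Omega> \<and> GDERIV f (u i) :> g i) \<and>
                           u \<longlonglongrightarrow> x \<and> g \<longlonglongrightarrow> v}"

definition critical_point :: "'a::euclidean_space set \<Rightarrow> ('a \<Rightarrow> real) \<Rightarrow> 'a \<Rightarrow> bool" where
  "critical_point \<Omega> f x \<longleftrightarrow> 0 \<in> clarke_subdifferential \<Omega> f x"

definition critical_value :: "'a::euclidean_space set \<Rightarrow> ('a \<Rightarrow> real) \<Rightarrow> real \<Rightarrow> bool" where
  "critical_value \<Omega> f r \<longleftrightarrow> (\<exists>x. critical_point \<Omega> f x \<and> r = f x)"

definition limit_point :: "(nat \<Rightarrow> 'a::topological_space) \<Rightarrow> 'a \<Rightarrow> bool" where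
  "limit_point X l \<longleftrightarrow> (\<exists>r. strict_mono r \<and> (X \<circ> r) \<longlonglongrightarrow> l)"

text \<open>Curves on \<open>[0, \<infinity>)\<close> are total functions on \<^typ>\<open>real\<close> whose values at negative times are
  irrelevant.\<close>

definition abs_continuous_curve :: "(real \<Rightarrow> 'a::euclidean_space) \<Rightarrow> bool" where
  "abs_continuous_curve z \<longleftrightarrow>
     (\<exists>v. (\<forall>a b. 0 \<le> a \<longrightarrow> v absolutely_integrable_on {a..b}) \<and>
          (\<forall>t\<ge>0. z t = z 0 + integral {0..t} v))"

definition subgradient_trajectory ::
    "'a::euclidean_space set \<Rightarrow> ('a \<Rightarrow> real) \<Rightarrow> (real \<Rightarrow> 'a) \<Rightarrow> bool" where
  "subgradient_trajectory \<Omega> f z \<longleftrightarrow>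
     abs_continuous_curve z \<and>
     (AE t in lebesgue. 0 \<le> t \<longrightarrow>
        (\<exists>d. (z has_vector_derivative d) (at t within {0..}) \<and>
             d \<in> uminus ` clarke_subdifferential \<Omega> f (z t)))"

definition history ::
    "'w measure \<Rightarrow> (nat \<Rightarrow> 'w \<Rightarrow> 'a::topological_space) \<Rightarrow> (nat \<Rightarrow> 'w \<Rightarrow> 'a) \<Rightarrow>
      (nat \<Rightarrow> 'w \<Rightarrow> 'a) \<Rightarrow> nat \<Rightarrow> 'w measure" where
  "history M x y \<xi> k = sigma (space M)
     ({x j -` B \<inter> space M | j B. 1 \<le> j \<and> j \<le> k \<and> B \<in> sets borel} \<union>
      {y j -` B \<inter> space M | j B. 1 \<le> j \<and> j \<le> k \<and> B \<in> sets borel} \<union>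
      {\<xi> i -` B \<inter> space M | i B. 1 \<le> i \<and> i < k \<and> B \<in> sets borel})"

text \<open>Componentwise conditional expectation.  As \<^const>\<open>real_cond_exp\<close> is the difference of the
  conditional expectations of the positive and the negative part, this is also the right (generalized)
  conditional expectation when the variable is not integrable but the conditional expectation
  of its norm is almost surely finite, for instance when its conditional second moment is.\<close>

definition vec_cond_exp ::
    "'w measure \<Rightarrow> 'w measure \<Rightarrow> ('w \<Rightarrow> 'a::euclidean_space) \<Rightarrow> 'w \<Rightarrow> 'a" where
  "vec_cond_exp M F X \<omega> = (\<Sum>b\<in>Basis. real_cond_exp M F (\<lambda>\<omega>'. X \<omega>' \<bullet> b) \<omega> *\<^sub>R b)"

end

theory Submission
  imports Defs "HOL-Complex_Analysis.Great_Picard"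
begin

text \<open>
  Where the weighted noise series converges, subtracting its tail from the iterates leaves a
  recursion \<open>u (Suc k) = u k - \<alpha> k *\<^sub>R y k\<close> without noise that is asymptotic to the iterates. Its
  time-shifted interpolations are asymptotically equi-Lipschitz, so along a subsequence they converge
  to a Lipschitz curve \<open>z\<close>. The difference quotients of \<open>z\<close> are limits of averages of nearby
  subgradients; as the Clarke subdifferential is convex, compact and outer semicontinuous, \<open>z\<close> is a
  subgradient trajectory at each of its points of differentiability, that is, almost everywhere.
  If the function values oscillated, a limit curve started at the last exit from a noncritical
  level \<open>r\<close> would have to drop strictly below \<open>r\<close> without having risen above it, contradicting the
  upcrossing. So the values converge, \<open>f\<close> is constant along every limit curve, and the descent
  property forces limit points to be critical. The noise series converges almost surely by
  Kolmogorov's maximal inequality for the increments truncated to bounded iterates.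
\<close>

section \<open>Lipschitz curves are absolutely continuous\<close>

text \<open>Two obstacles shape the proof. First, the noise has only a conditional second moment
  bounded by \<open>p (x k)\<close>, so it need not be square integrable. Truncating by the event
  that the current iterate lies in a fixed ball repairs this, and as that event is already decided
  by the history, conditional mean zero survives. Second, nothing is known about single steps in the
  limit. What passes to the limit is an average: the displacement of \<open>u\<close> over a stretch
  of time, divided by the elapsed time, is a convex combination of negative subgradients. Turning
  this into a differential inclusion needs derivatives of Lipschitz curves almost everywhere,
  obtained by Lebesgue's comparison of derived numbers for components made monotone by a linear
  term. Density of the noncritical values is enough because a single noncritical level between two
  oscillation levels is used. The limit curve starts exactly at that level: the iterates just before
  and just after the exit lie on opposite sides of it, and the steps shrink to zero.\<close>

text \<open>The intervals need only contain \<open>x\<close>, not be centred there, which suits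
  slopes taken over an interval around \<open>x\<close>; \<open>P\<close> will be a condition on
  such slopes. Indexing by pairs keeps the endpoints available for it.\<close>

lemma Vitali_covering_open_intervals:
  fixes A U :: "real set"
  assumes "open U" "A \<subseteq> U"
    and small: "\<And>x e. x \<in> A \<Longrightarrow> e > 0 \<Longrightarrow> \<exists>c d. c < x \<and> x < d \<and> d - c < e \<and> P c d"
  obtains C :: "(real \<times> real) set" where "countable C"
    "\<And>c d. (c, d) \<in> C \<Longrightarrow> c < d \<and> {c<..<d} \<subseteq> U \<and> P c d"
    "disjoint_family_on (\<lambda>(c, d). {c<..<d}) C"
    "negligible (A - (\<Union>(c, d)\<in>C. {c<..<d}))"
proof -
  define K where "K = {(c, d). c < d \<and> {c<..<d} \<subseteq> U \<and> P c d}"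
  define a r :: "real \<times> real \<Rightarrow> real"
    where "a = (\<lambda>(c, d). (c + d) / 2)" and "r = (\<lambda>(c, d). (d - c) / 2)"
  have ball_eq: "ball (a i) (r i) = (case i of (c, d) \<Rightarrow> {c<..<d})" for i
  proof (cases i)
    case (Pair c d)
    have "(c + d) / 2 - (d - c) / 2 = c" "(c + d) / 2 + (d - c) / 2 = d" by argo+
    then show ?thesis by (simp only: a_def r_def Pair prod.case ball_eq_greaterThanLessThan)
  qed
  have cover: "\<exists>i. i \<in> K \<and> x \<in> ball (a i) (r i) \<and> r i < e" if x: "x \<in> A" "0 < e" for x e
  proof -
    obtain e' where e': "e' > 0" "ball x e' \<subseteq> U"
      using assms(1,2) x(1) by (meson open_contains_ball subsetD)
    obtain c d where cd: "c < x" "x < d" "d - c < min e e'" "P c d"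
      using small[OF x(1), of "min e e'"] x e' by auto
    have "{c<..<d} \<subseteq> ball x e'"
      using cd by (auto simp: dist_real_def)
    then have "(c, d) \<in> K" using cd e' by (auto simp: K_def)
    moreover have "x \<in> ball (a (c, d)) (r (c, d))"
      using cd by (simp add: ball_eq)
    moreover have "r (c, d) < e" using cd x by (simp add: r_def)
    ultimately show ?thesis by blast
  qed
  from Vitali_covering_theorem_balls[of A K a r, OF cover]
  obtain C where C: "countable C" "C \<subseteq> K"
     "pairwise (\<lambda>i j. disjnt (ball (a i) (r i)) (ball (a j) (r j))) C"
     "negligible(A - (\<Union>i \<in> C. ball (a i) (r i)))"
    by (metis (no_types, lifting))
  show ?thesis
  proof
    show "countable C" by fact
    show "c < d \<and> {c<..<d} \<subseteq> U \<and> P c d" if "(c, d) \<in> C" for c d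
      using C(2) that by (auto simp: K_def)
    show "disjoint_family_on (\<lambda>(c, d). {c<..<d}) C"
      using C(3) by (simp add: ball_eq pairwise_def disjnt_def disjoint_family_on_def)
    show "negligible (A - (\<Union>(c, d)\<in>C. {c<..<d}))"
      using C(4) by (simp add: ball_eq)
  qed
qed

text \<open>Continuity of \<open>F\<close> leaves no mass at the endpoint \<open>b\<close>, by which
  the half-open interval exceeds the open one.\<close>

lemma emeasure_interval_measure_Ioo:
  fixes F :: "real \<Rightarrow> real"
  assumes "a < b" and mono: "mono F" and cont: "continuous_on UNIV F"
  shows "emeasure (interval_measure F) {a<..<b} = ennreal (F b - F a)"
proof -
  have F_mono: "\<And>x y. x \<le> y \<Longrightarrow> F x \<le> F y" using mono by (auto dest: monoD)
  have rc: "continuous (at_right y) F" for y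
    using cont by (metis continuous_on_eq_continuous_at open_UNIV UNIV_I continuous_at_imp_continuous_at_within)
  have fin: "emeasure (interval_measure F) {b..b} = 0"
    using emeasure_interval_measure_Icc[of b b F] cont F_mono by auto
  have "emeasure (interval_measure F) {a<..b} = ennreal (F b - F a)"
    using assms(1) F_mono rc by (intro emeasure_interval_measure_Ioc) auto
  moreover have "emeasure (interval_measure F) {a<..b}
      = emeasure (interval_measure F) {a<..<b} + emeasure (interval_measure F) {b..b}"
    using \<open>a < b\<close> by (subst plus_emeasure) (auto intro!: arg_cong2[where f = emeasure])
  ultimately show ?thesis using fin by simp
qed

text \<open>Countable additivity on both sides reduces the comparison to single intervals. It will
  relate Lebesgue and Stieltjes measure, with a slope bound as one factor and 1 as the
  other.\<close>

lemma emeasure_disjoint_intervals_mono: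
  fixes C :: "(real \<times> real) set"
  assumes "countable C" and disj: "disjoint_family_on (\<lambda>(c, d). {c<..<d}) C"
    and sets: "sets M = sets borel" "sets N = sets borel"
    and le: "\<And>c d. (c, d) \<in> C \<Longrightarrow> k * emeasure M {c<..<d} \<le> l * emeasure N {c<..<d}"
  shows "k * emeasure M (\<Union>(c, d)\<in>C. {c<..<d}) \<le> l * emeasure N (\<Union>(c, d)\<in>C. {c<..<d})"
proof -
  let ?I = "\<lambda>(c, d). {c<..<d} :: real set"
  have eq: "emeasure M' (\<Union>(c, d)\<in>C. {c<..<d}) = (\<integral>\<^sup>+ i. emeasure M' (?I i) \<partial>count_space C)"
    if "sets M' = sets borel" for M'
    using assms(1) disj by (intro emeasure_UN_countable) (auto simp: that split: prod.split)
  show ?thesis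
    unfolding eq[OF sets(1)] eq[OF sets(2)]
    using le by (auto simp flip: nn_integral_cmult intro!: nn_integral_mono split: prod.split)
qed

text \<open>The quotient in \<open>freq\<close> has \<open>x\<close> as an endpoint, whereas a
  Vitali cover needs \<open>x\<close> inside. Since \<open>S\<close> is open and \<open>F\<close>
  continuous, that endpoint can be pushed slightly past \<open>x\<close> without the slope leaving
  \<open>S\<close>.\<close>

lemma derived_number_intervals:
  fixes F :: "real \<Rightarrow> real" and P :: "real \<Rightarrow> bool"
  assumes cont: "continuous_on UNIV F" and "open S"
    and freq: "\<exists>\<^sub>F h in at 0. (F (x + h) - F x) / h \<in> S" and "e > 0"
  shows "\<exists>c d. c < x \<and> x < d \<and> d - c < e \<and> (F d - F c) / (d - c) \<in> S"
proof -
  \<comment> \<open>The other half of \<open>e\<close> is reserved for moving the endpoint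
    \<open>x\<close>.\<close>
  have "\<exists>h. h \<noteq> 0 \<and> \<bar>h\<bar> < e / 2 \<and> (F (x + h) - F x) / h \<in> S"
  proof -
    have "\<forall>d>0. \<exists>h. h \<noteq> 0 \<and> dist h 0 < d \<and> (F (x + h) - F x) / h \<in> S"
      using freq unfolding frequently_at by auto
    from this[rule_format, of "e / 2"] show ?thesis using \<open>e > 0\<close> by simp
  qed
  then obtain h where h: "h \<noteq> 0" "\<bar>h\<bar> < e / 2" "(F (x + h) - F x) / h \<in> S" by blast
  have isC: "isCont F y" for y
    using cont by (simp add: continuous_on_eq_continuous_at)
  have lim: "(F \<longlongrightarrow> F x) (at x within T)" for T
    using isC[of x] continuous_at_imp_continuous_within continuous_within by blast
  show ?thesis
  proof (cases "h > 0")
    case True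
    have "((\<lambda>c. (F (x + h) - F c) / (x + h - c)) \<longlongrightarrow> (F (x + h) - F x) / (x + h - x)) (at_left x)"
      using True by (intro tendsto_intros lim) auto
    then have "\<forall>\<^sub>F c in at_left x. (F (x + h) - F c) / (x + h - c) \<in> S"
      using h assms(2) by (auto dest: topological_tendstoD)
    moreover have "\<forall>\<^sub>F c in at_left x. x - e/2 < c \<and> c < x"
      using \<open>e > 0\<close> by (intro eventually_at_leftI[of "x - e/2"]) auto
    ultimately have "\<forall>\<^sub>F c in at_left x. (F (x + h) - F c) / (x + h - c) \<in> S \<and> x - e/2 < c \<and> c < x"
      by (rule eventually_conj)
    then obtain c where "(F (x + h) - F c) / (x + h - c) \<in> S" "x - e/2 < c" "c < x"
      using eventually_happens trivial_limit_at_left_real by fastforce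
    then show ?thesis using h True by (intro exI[of _ c] exI[of _ "x + h"]) auto
  next
    case False
    then have "h < 0" using h by auto
    have "((\<lambda>d. (F d - F (x + h)) / (d - (x + h))) \<longlongrightarrow> (F x - F (x + h)) / (x - (x + h))) (at_right x)"
      using \<open>h < 0\<close> by (intro tendsto_intros lim) auto
    moreover have "(F x - F (x + h)) / (x - (x + h)) = (F (x + h) - F x) / h"
      using h by (simp add: field_simps)
    ultimately have "\<forall>\<^sub>F d in at_right x. (F d - F (x + h)) / (d - (x + h)) \<in> S"
      using h assms(2) by (auto dest: topological_tendstoD)
    moreover have "\<forall>\<^sub>F d in at_right x. x < d \<and> d < x + e/2"
      using \<open>e > 0\<close> by (intro eventually_at_rightI[of _ "x + e/2"]) auto
    ultimately have "\<forall>\<^sub>F d in at_right x. (F d - F (x + h)) / (d - (x + h)) \<in> S \<and> x < d \<and> d < x + e/2"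
      by (rule eventually_conj)
    then obtain d where "(F d - F (x + h)) / (d - (x + h)) \<in> S" "x < d" "d < x + e/2"
      using eventually_happens trivial_limit_at_right_real by fastforce
    then show ?thesis using h \<open>h < 0\<close> by (intro exI[of _ "x + h"] exI[of _ d]) auto
  qed
qed

text \<open>A Vitali cover by intervals of slope below \<open>p\<close>, refined by one of slope above \<open>q\<close>, shrinks any
  open cover of the set in measure by the factor \<open>p / q\<close>.\<close>

lemma negligible_derived_number_gap:
  fixes F :: "real \<Rightarrow> real"
  assumes mono: "mono F" and cont: "continuous_on UNIV F" and pq: "0 \<le> p" "p < q"
  shows "negligible {x \<in> {-n<..<n}. (\<exists>\<^sub>F h in at 0. (F (x + h) - F x) / h < p) \<and>
                                     (\<exists>\<^sub>F h in at 0. q < (F (x + h) - F x) / h)}"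
    (is "negligible ?A")
proof -
  \<comment> \<open>The Stieltjes measure of \<open>F\<close> turns slope bounds on disjoint
    intervals into inequalities between measures.\<close>
  let ?\<mu> = "interval_measure F"
  \<comment> \<open>The term with \<open>e\<close> pays for an open set around the null part of
    \<open>?A\<close> that the two Vitali families miss.\<close>
  have step: "\<exists>U'. open U' \<and> ?A \<subseteq> U' \<and> U' \<in> lmeasurable \<and>
      q * measure lebesgue U' \<le> p * measure lebesgue U + q * e"
    if U: "open U" "?A \<subseteq> U" "U \<in> lmeasurable" and "e > 0" for U and e :: real
  proof -
    have "\<exists>c d. c < x \<and> x < d \<and> d - c < e' \<and> (F d - F c) / (d - c) \<in> {..<p}"
      if "x \<in> ?A" "e' > 0" for x e'
      using that derived_number_intervals[OF cont, of "{..<p}" x e'] by auto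
    from Vitali_covering_open_intervals[OF U(1,2) this]
    obtain C1 where C1: "countable C1" "disjoint_family_on (\<lambda>(c, d). {c<..<d}) C1"
      "\<And>c d. (c, d) \<in> C1 \<Longrightarrow> c < d \<and> {c<..<d} \<subseteq> U \<and> (F d - F c) / (d - c) \<in> {..<p}"
      "negligible (?A - (\<Union>(c, d)\<in>C1. {c<..<d}))"
      by (smt (verit, best))
    define V where "V = (\<Union>(c, d)\<in>C1. {c<..<d})"
    have V: "open V" "V \<subseteq> U"
      using C1(3) by (auto simp: V_def intro!: open_UN)
    have "\<exists>c d. c < x \<and> x < d \<and> d - c < e' \<and> (F d - F c) / (d - c) \<in> {q<..}"
      if "x \<in> ?A \<inter> V" "e' > 0" for x e'
      using that derived_number_intervals[OF cont, of "{q<..}" x e'] by auto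
    from Vitali_covering_open_intervals[OF V(1) Int_lower2 this]
    obtain C2 where C2: "countable C2" "disjoint_family_on (\<lambda>(c, d). {c<..<d}) C2"
      "\<And>c d. (c, d) \<in> C2 \<Longrightarrow> c < d \<and> {c<..<d} \<subseteq> V \<and> (F d - F c) / (d - c) \<in> {q<..}"
      "negligible (?A \<inter> V - (\<Union>(c, d)\<in>C2. {c<..<d}))"
      by (smt (verit, best))
    define W where "W = (\<Union>(c, d)\<in>C2. {c<..<d})"
    have W: "open W" "W \<subseteq> V"
      using C2(3) by (auto simp: W_def intro!: open_UN)
    \<comment> \<open>With \<open>|S|\<close> for Lebesgue measure, the chain is
      \<open>q * |W| <= ?\<mu> W <= ?\<mu> V <= p * |V| <= p * |U|\<close>.\<close>
    have "ennreal q * emeasure lborel W \<le> 1 * emeasure ?\<mu> W"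
      unfolding W_def
    proof (rule emeasure_disjoint_intervals_mono[OF C2(1,2)])
      fix c d assume "(c, d) \<in> C2"
      from C2(3)[OF this] have cd: "c < d" "q * (d - c) \<le> F d - F c"
        by (auto simp: field_simps)
      show "ennreal q * emeasure lborel {c<..<d} \<le> 1 * emeasure ?\<mu> {c<..<d}"
        using cd pq by (simp add: emeasure_interval_measure_Ioo[OF _ mono cont] ennreal_leI flip: ennreal_mult)
    qed auto
    also have "\<dots> \<le> 1 * emeasure ?\<mu> V"
      using W V by (auto intro!: emeasure_mono)
    also have "\<dots> \<le> ennreal p * emeasure lborel V"
      unfolding V_def
    proof (rule emeasure_disjoint_intervals_mono[OF C1(1,2)])
      fix c d assume "(c, d) \<in> C1"
      from C1(3)[OF this] have cd: "c < d" "F d - F c \<le> p * (d - c)"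
        by (auto simp: field_simps)
      show "1 * emeasure ?\<mu> {c<..<d} \<le> ennreal p * emeasure lborel {c<..<d}"
        using cd pq by (simp add: emeasure_interval_measure_Ioo[OF _ mono cont] ennreal_leI flip: ennreal_mult)
    qed auto
    also have "\<dots> \<le> ennreal p * emeasure lborel U"
      using U V by (intro mult_left_mono emeasure_mono) auto
    finally have *: "ennreal q * emeasure lborel W \<le> ennreal p * emeasure lborel U" .
    have lm: "S \<in> lmeasurable \<and> emeasure lborel S = ennreal (measure lebesgue S)"
      if "open S" "S \<subseteq> U" for S
    proof
      show S: "S \<in> lmeasurable"
        using that U by (auto intro: fmeasurableI2)
      have "emeasure lborel S = emeasure lebesgue S" using that by simp
      also have "\<dots> = ennreal (measure lebesgue S)"
        using S by (simp add: emeasure_eq_measure2)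
      finally show "emeasure lborel S = ennreal (measure lebesgue S)" .
    qed
    have WU: "W \<subseteq> U" using W V by simp
    have **: "q * measure lebesgue W \<le> p * measure lebesgue U"
      using * lm[OF W(1) WU] lm[OF U(1) order_refl] pq
      by (simp flip: ennreal_mult)
    have neg: "negligible (?A - W)"
      by (rule negligible_subset[OF negligible_Un[OF C1(4) C2(4)]]) (auto simp: V_def W_def)
    then have "?A - W \<in> lmeasurable" "measure lebesgue (?A - W) = 0"
      by (auto intro: negligible_imp_measurable negligible_imp_measure0)
    then obtain T where T: "open T" "?A - W \<subseteq> T" "T \<in> lmeasurable" "measure lebesgue T < e"
    proof -
      assume N: "?A - W \<in> lmeasurable" "measure lebesgue (?A - W) = 0"
      obtain T where T: "open T" "?A - W \<subseteq> T" "T - (?A - W) \<in> lmeasurable"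
          "emeasure lebesgue (T - (?A - W)) < ennreal e"
        using sets_lebesgue_outer_open[of "?A - W" e] N \<open>e > 0\<close> by auto
      have T_eq: "T = (?A - W) \<union> (T - (?A - W))" using T by auto
      have "measure lebesgue (T - (?A - W)) < e"
        using T(3,4) \<open>e > 0\<close> by (simp add: emeasure_eq_measure2 ennreal_less_iff)
      moreover have "measure lebesgue T \<le> measure lebesgue (?A - W) + measure lebesgue (T - (?A - W))"
        by (subst T_eq, intro measure_Un_le) (use N T in auto)
      ultimately have "measure lebesgue T < e" using N by simp
      moreover have "T \<in> lmeasurable"
        by (subst T_eq, intro fmeasurable.Un) (use N T in auto)
      ultimately show thesis using T that by blast
    qed
    have "measure lebesgue (W \<union> T) \<le> measure lebesgue W + measure lebesgue T"
      using lm[OF W(1) WU] T by (intro measure_Un_le) auto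
    also have "\<dots> \<le> measure lebesgue W + e" using T by simp
    finally have "q * measure lebesgue (W \<union> T) \<le> q * (measure lebesgue W + e)"
      using pq by (intro mult_left_mono) auto
    also have "\<dots> \<le> p * measure lebesgue U + q * e"
      using ** by (simp add: algebra_simps)
    finally show ?thesis
      using W T lm[OF W(1) WU] by (intro exI[of _ "W \<union> T"]) auto
  qed
  \<comment> \<open>\<open>Inf X\<close> is the outer measure of \<open>?A\<close>. Shrinking nearly
    optimal covers yields \<open>q * Inf X <= p * Inf X\<close>, and \<open>p < q\<close> then
    leaves no positive value.\<close>
  define X where "X = {measure lebesgue U | U. open U \<and> ?A \<subseteq> U \<and> U \<in> lmeasurable}"
  have "X \<noteq> {}"
    unfolding X_def by (auto intro!: exI[of _ "{-n<..<n}"])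
  moreover have bdd: "bdd_below X"
    unfolding X_def by (intro bdd_belowI[of _ 0]) auto
  ultimately have approx: "\<exists>x\<in>X. x < Inf X + e" if "e > 0" for e
    using cInf_less_iff[of X "Inf X + e"] that by auto
  have "q * Inf X \<le> p * Inf X + e" if "e > 0" for e
  proof -
    \<comment> \<open>Choosing \<open>U\<close> near the infimum costs \<open>p * e'\<close> and the
      shrinking step \<open>q * e'\<close>, together \<open>e\<close>.\<close>
    define e' where "e' = e / (p + q)"
    have e': "e' > 0" using that pq by (simp add: e'_def)
    obtain U where U: "open U" "?A \<subseteq> U" "U \<in> lmeasurable" "measure lebesgue U < Inf X + e'"
      using approx[OF e'] unfolding X_def by blast
    obtain U' where U': "open U'" "?A \<subseteq> U'" "U' \<in> lmeasurable"
        "q * measure lebesgue U' \<le> p * measure lebesgue U + q * e'"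
      using step[OF U(1-3) e'] by blast
    have "measure lebesgue U' \<in> X" using U' unfolding X_def by blast
    then have "Inf X \<le> measure lebesgue U'" using bdd by (intro cInf_lower)
    then have "q * Inf X \<le> q * measure lebesgue U'"
      using pq by (intro mult_left_mono) auto
    also have "\<dots> \<le> p * (Inf X + e') + q * e'"
      using U'(4) mult_left_mono[of "measure lebesgue U" "Inf X + e'" p] U(4) pq by auto
    also have "\<dots> = p * Inf X + (p + q) * e'"
      by (simp add: algebra_simps)
    also have "(p + q) * e' = e" using pq by (simp add: e'_def)
    finally show ?thesis .
  qed
  then have "q * Inf X \<le> p * Inf X" by (rule field_le_epsilon)
  then have "(q - p) * Inf X \<le> 0" by (simp add: algebra_simps)
  then have "Inf X \<le> 0" using pq by (simp add: mult_le_0_iff)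
  then show ?thesis
    unfolding negligible_outer using approx X_def by (smt (verit, best) mem_Collect_eq)
qed

text \<open>Without a limit, the finite lower and upper limits differ and two rationals fit between
  them. Rational levels keep the exceptional sets countable when this is applied to difference
  quotients; it is applied to the values of \<open>f\<close> as well.\<close>

lemma tendsto_if_no_oscillation:
  fixes g :: "'b \<Rightarrow> real"
  assumes "G \<noteq> bot" and bdd: "\<forall>\<^sub>F x in G. \<bar>g x\<bar> \<le> B"
    and gap: "\<And>p q. p \<in> \<rat> \<Longrightarrow> q \<in> \<rat> \<Longrightarrow> p < q \<Longrightarrow> \<exists>\<^sub>F x in G. g x < p \<Longrightarrow> \<exists>\<^sub>F x in G. q < g x \<Longrightarrow> False"
  shows "\<exists>l. (g \<longlongrightarrow> l) G"
proof -
  let ?g = "\<lambda>x. ereal (g x)"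
  have lo: "ereal (-B) \<le> Liminf G ?g"
    using bdd by (intro Liminf_bounded) (auto elim!: eventually_mono)
  have hi: "Limsup G ?g \<le> ereal B"
    using bdd by (intro Limsup_bounded) (auto elim!: eventually_mono)
  have "\<not> Liminf G ?g < Limsup G ?g"
  proof
    assume "Liminf G ?g < Limsup G ?g"
    then obtain r where r: "Liminf G ?g < ereal r" "ereal r < Limsup G ?g"
      using ereal_dense2 by blast
    obtain s where s: "ereal r < ereal s" "ereal s < Limsup G ?g"
      using ereal_dense2[OF r(2)] by blast
    obtain p where p: "p \<in> \<rat>" "r < p" "p < s" using Rats_dense_in_real[of r s] s by auto
    obtain q where q: "q \<in> \<rat>" "p < q" "q < s" using Rats_dense_in_real[of p s] p by auto
    have "\<exists>\<^sub>F x in G. g x < p"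
    proof (rule ccontr)
      assume "\<not> (\<exists>\<^sub>F x in G. g x < p)"
      then have "ereal p \<le> Liminf G ?g"
        by (intro Liminf_bounded) (auto simp: not_frequently not_less)
      then show False using r p by (meson ereal_less_eq(3) le_less_trans less_imp_le not_less order_trans)
    qed
    moreover have "\<exists>\<^sub>F x in G. q < g x"
    proof (rule ccontr)
      assume "\<not> (\<exists>\<^sub>F x in G. q < g x)"
      then have "Limsup G ?g \<le> ereal q"
        by (intro Limsup_bounded) (auto simp: not_frequently not_less)
      then show False using s q by (meson ereal_less_eq(3) le_less_trans less_imp_le not_less order_trans)
    qed
    ultimately show False using gap p q by blast
  qed
  then have eq: "Liminf G ?g = Limsup G ?g"
    using Liminf_le_Limsup[OF assms(1), of ?g] by simp
  obtain l where l: "Limsup G ?g = ereal l"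
    using lo hi eq by (cases "Limsup G ?g") auto
  have "(?g \<longlongrightarrow> ereal l) G"
    using Liminf_eq_Limsup[OF assms(1), of ?g "ereal l"] eq l by simp
  then show ?thesis by auto
qed

text \<open>The difference quotients lie between \<open>0\<close> and \<open>|B|\<close>, so they
  can fail to converge only by oscillating across a rational gap. Gaps and bounds \<open>n\<close>
  together form a countable family.\<close>

lemma negligible_not_differentiable_mono:
  fixes F :: "real \<Rightarrow> real"
  assumes mono: "mono F" and lip: "B-lipschitz_on UNIV F"
  shows "negligible {x. \<not> F differentiable at x}"
proof -
  define A where "A = (\<lambda>(n::nat, p, q). {x \<in> {-real n<..<real n}.
     (\<exists>\<^sub>F h in at 0. (F (x + h) - F x) / h < p) \<and> (\<exists>\<^sub>F h in at 0. q < (F (x + h) - F x) / h)})"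
  define I where "I = {i \<in> (UNIV :: nat set) \<times> \<rat> \<times> (\<rat> :: real set). 0 \<le> fst (snd i) \<and> fst (snd i) < snd (snd i)}"
  have cont: "continuous_on UNIV F" using lip by (rule lipschitz_on_continuous_on)
  have "countable I"
    unfolding I_def by (rule countable_subset[of _ "(UNIV :: nat set) \<times> \<rat> \<times> (\<rat> :: real set)"]) (auto intro!: countable_SIGMA countable_rat countableI_type)
  then have "negligible (\<Union>i\<in>I. A i)"
    using negligible_derived_number_gap[OF mono cont]
    by (intro negligible_countable_Union countable_image) (auto simp: A_def I_def)
  moreover have "{x. \<not> F differentiable at x} \<subseteq> (\<Union>i\<in>I. A i)"
  proof
    fix x assume "x \<in> {x. \<not> F differentiable at x}"
    then have nd: "\<not> F differentiable at x" by simp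
    let ?Q = "\<lambda>h. (F (x + h) - F x) / h"
    have Q0: "?Q h \<ge> 0" for h
      using monoD[OF mono, of x "x + h"] monoD[OF mono, of "x + h" x]
      by (cases "h \<ge> 0") (auto intro: divide_nonpos_nonpos)
    have QB: "\<bar>?Q h\<bar> \<le> \<bar>B\<bar>" for h
    proof (cases "h = 0")
      case False
      have "\<bar>F (x + h) - F x\<bar> \<le> B * \<bar>h\<bar>"
        using lipschitz_onD[OF lip, of "x + h" x] by (simp add: dist_real_def)
      also have "\<dots> \<le> \<bar>B\<bar> * \<bar>h\<bar>" by (intro mult_right_mono) auto
      finally show ?thesis using False by (simp add: field_simps abs_divide)
    qed simp
    have "\<not> (\<exists>l. (?Q \<longlongrightarrow> l) (at 0))"
      using nd by (auto simp: real_differentiable_def DERIV_def)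
    then have "\<not> (\<forall>p q. p \<in> \<rat> \<longrightarrow> q \<in> \<rat> \<longrightarrow> p < q \<longrightarrow> (\<exists>\<^sub>F h in at 0. ?Q h < p) \<longrightarrow> (\<exists>\<^sub>F h in at 0. q < ?Q h) \<longrightarrow> False)"
      using tendsto_if_no_oscillation[of "at 0" ?Q "\<bar>B\<bar>"] QB by (auto intro: always_eventually)
    then obtain p q where pq: "p \<in> \<rat>" "q \<in> \<rat>" "p < q" "\<exists>\<^sub>F h in at 0. ?Q h < p" "\<exists>\<^sub>F h in at 0. q < ?Q h"
      by blast
    from frequently_ex[OF pq(4)] obtain h where "?Q h < p" by blast
    \<comment> \<open>Some nonnegative quotient lies below \<open>p\<close>, which gives the sign
      condition in \<open>I\<close>.\<close>
    then have "0 \<le> p" using Q0[of h] by linarith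
    obtain n :: nat where "\<bar>x\<bar> < real n" using reals_Archimedean2 by blast
    then have "x \<in> A (n, p, q)" using pq by (auto simp: A_def)
    moreover have "(n, p, q) \<in> I" using pq \<open>0 \<le> p\<close> by (simp add: I_def)
    ultimately show "x \<in> (\<Union>i\<in>I. A i)" by blast
  qed
  ultimately show ?thesis by (rule negligible_subset)
qed

text \<open>Adding \<open>L * s\<close> outweighs the steepest descent of a component and makes it
  monotone; a linear term does not affect differentiability.\<close>

lemma negligible_not_differentiable_lipschitz:
  fixes z :: "real \<Rightarrow> 'a::euclidean_space"
  assumes lip: "L-lipschitz_on UNIV z"
  shows "negligible {t. \<not> z differentiable at t}"
proof -
  have "negligible {t. \<not> (\<lambda>s. z s \<bullet> b) differentiable at t}" if b: "b \<in> Basis" for b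
  proof -
    let ?F = "\<lambda>s. z s \<bullet> b + L * s"
    have L: "L \<ge> 0" using lip by (rule lipschitz_on_nonneg)
    have le: "\<bar>z s \<bullet> b - z t \<bullet> b\<bar> \<le> L * \<bar>s - t\<bar>" for s t
    proof -
      have "\<bar>z s \<bullet> b - z t \<bullet> b\<bar> = \<bar>(z s - z t) \<bullet> b\<bar>" by (simp add: inner_diff_left)
      also have "\<dots> \<le> norm (z s - z t)" using b by (rule Basis_le_norm)
      also have "\<dots> \<le> L * \<bar>s - t\<bar>" using lipschitz_onD[OF lip, of s t] by (simp add: dist_norm)
      finally show ?thesis .
    qed
    have "mono ?F"
    proof (rule monoI)
      fix s t :: real assume "s \<le> t"
      then show "?F s \<le> ?F t" using le[of s t] by (simp add: algebra_simps)
    qed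
    moreover have "(2 * L)-lipschitz_on UNIV ?F"
    proof (rule lipschitz_onI)
      fix s t :: real
      have "\<bar>?F s - ?F t\<bar> = \<bar>(z s \<bullet> b - z t \<bullet> b) + L * (s - t)\<bar>"
        by (simp add: algebra_simps)
      also have "\<dots> \<le> L * \<bar>s - t\<bar> + L * \<bar>s - t\<bar>"
        using L by (intro order_trans[OF abs_triangle_ineq] add_mono le) (simp add: abs_mult)
      finally show "dist (?F s) (?F t) \<le> 2 * L * dist s t" by (simp add: dist_real_def)
    qed (use L in simp)
    ultimately have "negligible {x. \<not> ?F differentiable at x}"
      by (rule negligible_not_differentiable_mono)
    moreover have "{t. \<not> (\<lambda>s. z s \<bullet> b) differentiable at t} \<subseteq> {x. \<not> ?F differentiable at x}"
    proof safe
      fix t assume "?F differentiable at t"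
      then have "(\<lambda>s. ?F s - L * s) differentiable at t"
        by (intro differentiable_diff) auto
      moreover assume "\<not> (\<lambda>s. z s \<bullet> b) differentiable at t"
      ultimately show False by simp
    qed
    ultimately show ?thesis by (rule negligible_subset)
  qed
  then have "negligible (\<Union>b\<in>Basis. {t. \<not> (\<lambda>s. z s \<bullet> b) differentiable at t})"
    by (intro negligible_Union) auto
  then show ?thesis
    by (rule negligible_subset) (auto simp: differentiable_componentwise_within[of z])
qed

section \<open>Integrating the derivative of a Lipschitz curve\<close>

lemma has_vector_derivative_quotient:
  fixes z :: "real \<Rightarrow> 'a::real_normed_vector"
  assumes "(z has_vector_derivative d) (at t)"
  shows "((\<lambda>h. (z (t + h) - z t) /\<^sub>R h) \<longlongrightarrow> d) (at 0)"
proof -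
  have "((\<lambda>h. norm (z (t + h) - z t - h *\<^sub>R d) / norm h) \<longlongrightarrow> 0) (at 0)"
    using assms unfolding has_vector_derivative_def has_derivative_at by simp
  then have "((\<lambda>h. norm ((z (t + h) - z t) /\<^sub>R h - d)) \<longlongrightarrow> 0) (at 0)"
  proof (rule Lim_transform_eventually)
    show "\<forall>\<^sub>F h in at 0. norm (z (t + h) - z t - h *\<^sub>R d) / norm h = norm ((z (t + h) - z t) /\<^sub>R h - d)"
    proof (rule eventually_at_filter[THEN iffD2, OF always_eventually], intro allI impI)
      fix h :: real assume "h \<noteq> 0"
      then have "(z (t + h) - z t) /\<^sub>R h - d = (z (t + h) - z t - h *\<^sub>R d) /\<^sub>R h"
        by (simp add: scaleR_diff_right)
      then show "norm (z (t + h) - z t - h *\<^sub>R d) / norm h = norm ((z (t + h) - z t) /\<^sub>R h - d)"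
        by (simp only: norm_scaleR) (simp add: divide_inverse)
    qed
  qed
  then show ?thesis
    using LIM_zero_iff tendsto_norm_zero_iff by blast
qed

text \<open>Difference quotients with steps \<open>h k\<close> are dominated by \<open>L\<close> and
  tend to \<open>v\<close>. Their integrals are differences of averages of \<open>z\<close> over
  \<open>[b, b + h k]\<close> and \<open>[a, a + h k]\<close>, which tend to
  \<open>z b - z a\<close> by continuity.\<close>

lemma lipschitz_integral_derivative:
  fixes z :: "real \<Rightarrow> 'a::euclidean_space"
  assumes lip: "L-lipschitz_on UNIV z" and "a \<le> b"
  defines "v \<equiv> \<lambda>t. if z differentiable at t then vector_derivative z (at t) else 0"
  shows "v absolutely_integrable_on {a..b}" "integral {a..b} v = z b - z a"
proof -
  define N where "N = {t. \<not> z differentiable at t}"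
  have N: "negligible N"
    unfolding N_def using lip by (rule negligible_not_differentiable_lipschitz)
  have L: "L \<ge> 0" using lip by (rule lipschitz_on_nonneg)
  have cont: "continuous_on S z" for S
    using lipschitz_on_continuous_on[OF lip] continuous_on_subset by blast
  define h where "h k = inverse (real (Suc k))" for k
  have h: "0 < h k" "h k \<le> 1" for k by (auto simp: h_def inverse_le_1_iff)
  have h0: "h \<longlonglongrightarrow> 0" unfolding h_def by (rule LIMSEQ_inverse_real_of_nat)
  have h_at: "filterlim h (at 0) sequentially"
    using h0 h(1) by (simp add: filterlim_at order_less_imp_not_eq2)
  define g where "g k t = (z (t + h k) - z t) /\<^sub>R h k" for k t
  \<comment> \<open>The value 0 on the null set \<open>N\<close> agrees with \<open>v\<close> there,
    so that convergence and the bound hold at every point, as the dominated convergence used below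
    demands.\<close>
  define f where "f k t = (if t \<in> N then 0 else g k t)" for k t
  have g_le: "norm (g k t) \<le> L" for k t
  proof -
    have "norm (g k t) = norm (z (t + h k) - z t) / h k"
      using h(1)[of k] by (simp add: g_def divide_inverse_commute)
    then show ?thesis
      using lipschitz_onD[OF lip, of "t + h k" t] h(1)[of k] by (simp add: dist_norm pos_divide_le_eq)
  qed
  have f_le: "norm (f k t) \<le> L" for k t
    using g_le L by (simp add: f_def)
  have f_lim: "(\<lambda>k. f k t) \<longlonglongrightarrow> v t" for t
  proof (cases "t \<in> N")
    case False
    then have "(z has_vector_derivative v t) (at t)"
      by (simp add: N_def v_def vector_derivative_works)
    then have "((\<lambda>h. (z (t + h) - z t) /\<^sub>R h) \<longlongrightarrow> v t) (at 0)"
      by (rule has_vector_derivative_quotient)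
    from filterlim_compose[OF this h_at] show ?thesis
      using False by (simp add: f_def g_def)
  qed (simp add: f_def v_def N_def)
  have g_int: "g k integrable_on {a..b}" for k
    unfolding g_def by (intro integrable_continuous_interval continuous_intros
        continuous_on_compose2[OF cont[of UNIV]]) (auto intro: cont)
  have f_int: "f k integrable_on {a..b}" for k
    by (rule integrable_spike[OF g_int N]) (simp add: f_def)
  have v_le: "norm (v t) \<le> L" for t
    by (rule Lim_bounded[OF tendsto_norm[OF f_lim]]) (use f_le in auto)
  have v_int: "v integrable_on {a..b}" and lim: "(\<lambda>k. integral {a..b} (f k)) \<longlonglongrightarrow> integral {a..b} v"
    using dominated_convergence[of f "{a..b}" "\<lambda>_. L" v] f_int f_le f_lim
    by (auto simp: integrable_const_ivl)
  show "v absolutely_integrable_on {a..b}"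
    using absolutely_integrable_integrable_bound[of "{a..b}" v "\<lambda>_. L"] v_le v_int
    by (auto simp: integrable_const_ivl)
  \<comment> \<open>The margins make the derivative of \<open>Z\<close> two-sided on
    \<open>{a..b+1}\<close>, which contains all \<open>t + h k\<close> with \<open>t\<close> in
    \<open>{a..b}\<close> because \<open>h k <= 1\<close>.\<close>
  obtain Z where Z0: "\<And>t. t \<in> {a-1..b+2} \<Longrightarrow> (Z has_vector_derivative z t) (at t within {a-1..b+2})"
    using antiderivative_continuous[OF cont] by metis
  have Z: "(Z has_vector_derivative z t) (at t)" if "t \<in> {a..b+1}" for t
    using Z0[of t] that at_within_Icc_at[of "a - 1" t "b + 2"] by auto
  have Zlim: "(\<lambda>k. (Z (t + h k) - Z t) /\<^sub>R h k) \<longlonglongrightarrow> z t" if "t \<in> {a..b+1}" for t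
  proof -
    have "((\<lambda>h. (Z (t + h) - Z t) /\<^sub>R h) \<longlongrightarrow> z t) (at 0)"
      using Z[OF that] by (rule has_vector_derivative_quotient)
    from filterlim_compose[OF this h_at] show ?thesis by simp
  qed
  have "integral {a..b} (f k) = (Z (b + h k) - Z b) /\<^sub>R h k - (Z (a + h k) - Z a) /\<^sub>R h k" for k
  proof -
    let ?Y = "\<lambda>t. (Z (t + h k) - Z t) /\<^sub>R h k"
    have "(?Y has_vector_derivative g k t) (at t within {a..b})" if "t \<in> {a..b}" for t
    proof -
      have "((\<lambda>t. Z (t + h k)) has_vector_derivative z (t + h k)) (at t)"
      proof -
        have "((\<lambda>t. t + h k) has_vector_derivative 1) (at t)"
          by (auto intro!: derivative_eq_intros)
        from vector_diff_chain_at[OF this Z[of "t + h k"]] show ?thesis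
          using h[of k] that by (auto simp: o_def)
      qed
      moreover have "(Z has_vector_derivative z t) (at t)" using Z that by auto
      ultimately have "((\<lambda>t. Z (t + h k) - Z t) has_vector_derivative (z (t + h k) - z t)) (at t)"
        by (rule has_vector_derivative_diff)
      from bounded_linear.has_vector_derivative[OF bounded_linear_scaleR_right this, of "inverse (h k)"]
      show ?thesis
        unfolding g_def by (rule has_vector_derivative_at_within)
    qed
    then have "(g k has_integral (?Y b - ?Y a)) {a..b}"
      using \<open>a \<le> b\<close> by (intro fundamental_theorem_of_calculus) auto
    moreover have "integral {a..b} (f k) = integral {a..b} (g k)"
      by (rule integral_spike[OF N]) (simp add: f_def)
    ultimately show ?thesis by (simp add: integral_unique)
  qed
  then have "(\<lambda>k. integral {a..b} (f k)) \<longlonglongrightarrow> z b - z a"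
    using Zlim[of a] Zlim[of b] \<open>a \<le> b\<close> by (simp add: tendsto_diff)
  with lim show "integral {a..b} v = z b - z a" by (rule LIMSEQ_unique)
qed

lemma lipschitz_abs_continuous_curve:
  fixes z :: "real \<Rightarrow> 'a::euclidean_space"
  assumes lip: "L-lipschitz_on UNIV z"
  shows "abs_continuous_curve z"
  unfolding abs_continuous_curve_def
proof (intro exI conjI allI impI)
  let ?v = "\<lambda>t. if z differentiable at t then vector_derivative z (at t) else 0"
  show "?v absolutely_integrable_on {a..b}" for a b
    using lipschitz_integral_derivative(1)[OF lip, of a b] by (cases "a \<le> b") auto
  show "z t = z 0 + integral {0..t} ?v" if "t \<ge> 0" for t
    using lipschitz_integral_derivative(2)[OF lip that] by simp
qed

section \<open>The Clarke subdifferential\<close>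

text \<open>In epsilon form, closedness and semicontinuity follow from the triangle inequality
  without diagonal sequences.\<close>

definition limiting_gradients :: "'a::euclidean_space set \<Rightarrow> ('a \<Rightarrow> real) \<Rightarrow> 'a \<Rightarrow> 'a set" where
  "limiting_gradients \<Omega> f x =
     {v. \<forall>e>0. \<exists>u\<in>\<Omega>. \<exists>g. GDERIV f u :> g \<and> dist u x < e \<and> dist g v < e}"

lemma LIMSEQ_if_dist_less_inverse:
  assumes "\<And>i. dist (u i) x < inverse (real (Suc i))"
  shows "u \<longlonglongrightarrow> x"
  by (rule metric_tendsto_imp_tendsto[OF LIMSEQ_inverse_real_of_nat])
     (use assms in \<open>auto intro!: always_eventually less_imp_le\<close>)

lemma clarke_subdifferential_eq_hull:
  "clarke_subdifferential \<Omega> f x = convex hull (limiting_gradients \<Omega> f x)"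
proof -
  have "v \<in> limiting_gradients \<Omega> f x"
    if u: "\<forall>i::nat. u i \<in> \<Omega> \<and> GDERIV f (u i) :> g i" "u \<longlonglongrightarrow> x" "g \<longlonglongrightarrow> v" for u g v
    unfolding limiting_gradients_def
  proof (intro CollectI allI impI)
    fix e :: real assume "e > 0"
    then have "\<forall>\<^sub>F i in sequentially. dist (u i) x < e \<and> dist (g i) v < e"
      using u by (intro eventually_conj tendstoD)
    then obtain i where "dist (u i) x < e \<and> dist (g i) v < e"
      using eventually_happens sequentially_bot by blast
    then show "\<exists>u\<in>\<Omega>. \<exists>g. GDERIV f u :> g \<and> dist u x < e \<and> dist g v < e"
      using u(1) by blast
  qed
  moreover have "\<exists>u g. (\<forall>i::nat. u i \<in> \<Omega> \<and> GDERIV f (u i) :> g i) \<and> u \<longlonglongrightarrow> x \<and> g \<longlonglongrightarrow> v"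
    if v: "v \<in> limiting_gradients \<Omega> f x" for v
  proof -
    have "\<forall>i::nat. \<exists>u g. u \<in> \<Omega> \<and> GDERIV f u :> g \<and> dist u x < inverse (real (Suc i)) \<and> dist g v < inverse (real (Suc i))"
    proof
      fix i :: nat
      have "inverse (real (Suc i)) > 0" by simp
      with v show "\<exists>u g. u \<in> \<Omega> \<and> GDERIV f u :> g \<and> dist u x < inverse (real (Suc i)) \<and> dist g v < inverse (real (Suc i))"
        unfolding limiting_gradients_def by blast
    qed
    then obtain u g where ug: "\<And>i::nat. u i \<in> \<Omega> \<and> GDERIV f (u i) :> g i"
        "\<And>i. dist (u i) x < inverse (real (Suc i))" "\<And>i. dist (g i) v < inverse (real (Suc i))"
      by metis
    have "u \<longlonglongrightarrow> x" "g \<longlonglongrightarrow> v"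
      using ug by (auto intro: LIMSEQ_if_dist_less_inverse)
    with ug show ?thesis by blast
  qed
  ultimately have "{v. \<exists>u g. (\<forall>i::nat. u i \<in> \<Omega> \<and> GDERIV f (u i) :> g i) \<and> u \<longlonglongrightarrow> x \<and> g \<longlonglongrightarrow> v}
      = limiting_gradients \<Omega> f x"
    by blast
  then show ?thesis unfolding clarke_subdifferential_def by simp
qed

text \<open>Along the direction \<open>g\<close> itself the derivative at \<open>x\<close> is
  \<open>g \<bullet> g\<close>, while the Lipschitz bound allows at most
  \<open>L * norm g\<close>.\<close>

lemma norm_gradient_le_lipschitz:
  fixes f :: "'a::euclidean_space \<Rightarrow> real"
  assumes lip: "L-lipschitz_on U f" and "open U" "x \<in> U" and g: "GDERIV f x :> g"
  shows "norm g \<le> L"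
proof -
  have L: "L \<ge> 0" using lip by (rule lipschitz_on_nonneg)
  let ?c = "\<lambda>t::real. x + t *\<^sub>R g"
  have c: "(?c has_derivative (\<lambda>t. t *\<^sub>R g)) (at 0)"
    by (auto intro!: derivative_eq_intros)
  have "(f has_derivative (\<lambda>h. h \<bullet> g)) (at (?c 0))"
    using g by (simp add: gderiv_def inner_commute)
  from diff_chain_at[OF c this]
  have "((\<lambda>t. f (?c t)) has_derivative (\<lambda>t. (g \<bullet> g) * t)) (at 0)"
    by (simp add: o_def mult.commute)
  then have "((\<lambda>t. f (?c t)) has_field_derivative (g \<bullet> g)) (at 0)"
    by (simp add: has_field_derivative_def)
  then have lim: "((\<lambda>t. (f (?c t) - f x) / t) \<longlongrightarrow> g \<bullet> g) (at 0)"
    by (simp add: DERIV_def)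
  have "(?c \<longlongrightarrow> ?c 0) (at 0)" by (intro tendsto_intros)
  then have "\<forall>\<^sub>F t in at 0. ?c t \<in> U"
    using assms(2,3) by (intro topological_tendstoD) auto
  then have "\<forall>\<^sub>F t in at 0. (f (?c t) - f x) / t \<le> L * norm g"
  proof (rule eventually_mono)
    fix t assume t: "?c t \<in> U"
    have "\<bar>f (?c t) - f x\<bar> \<le> L * (\<bar>t\<bar> * norm g)"
      using lipschitz_onD[OF lip t \<open>x \<in> U\<close>] by (simp add: dist_norm)
    then have "\<bar>(f (?c t) - f x) / t\<bar> \<le> L * norm g"
      using L by (cases "t = 0") (auto simp: abs_divide divide_le_eq ac_simps)
    then show "(f (?c t) - f x) / t \<le> L * norm g" by linarith
  qed
  from tendsto_upperbound[OF lim this] have "norm g * norm g \<le> L * norm g"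
    by (simp add: dot_square_norm power2_eq_square)
  then show ?thesis using L by (cases "g = 0") auto
qed

lemma norm_limiting_gradient_le_lipschitz:
  fixes f :: "'a::euclidean_space \<Rightarrow> real"
  assumes lip: "L-lipschitz_on U f" and "open U" "x \<in> U" and v: "v \<in> limiting_gradients \<Omega> f x"
  shows "norm v \<le> L"
proof (rule field_le_epsilon)
  fix e :: real assume "e > 0"
  obtain d where d: "d > 0" "ball x d \<subseteq> U" using assms(2,3) by (meson open_contains_ball)
  have "min d e > 0" using d \<open>e > 0\<close> by simp
  then obtain u g where u: "GDERIV f u :> g" "dist u x < min d e" "dist g v < min d e"
    using v unfolding limiting_gradients_def by blast
  have "u \<in> U" using u d by (auto simp: dist_commute subset_iff)
  then have "norm g \<le> L" using norm_gradient_le_lipschitz[OF lip \<open>open U\<close> _ u(1)] by simp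
  moreover have "norm v \<le> norm g + dist g v" by (metis dist_commute dist_norm norm_triangle_sub)
  ultimately show "norm v \<le> L + e" using u by simp
qed

lemma compact_limiting_gradients:
  fixes f :: "'a::euclidean_space \<Rightarrow> real"
  assumes "locally_lipschitz f"
  shows "compact (limiting_gradients \<Omega> f x)"
proof -
  obtain U L where UL: "open U" "x \<in> U" "L-lipschitz_on U f"
    using assms unfolding locally_lipschitz_def by blast
  have "bounded (limiting_gradients \<Omega> f x)"
    using norm_limiting_gradient_le_lipschitz[OF UL(3,1,2)] by (auto simp: bounded_iff)
  moreover have "closed (limiting_gradients \<Omega> f x)"
    unfolding closure_subset_eq[symmetric]
  proof
    fix v assume "v \<in> closure (limiting_gradients \<Omega> f x)"
    then have v: "\<forall>e>0. \<exists>w\<in>limiting_gradients \<Omega> f x. dist w v < e"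
      by (simp add: closure_approachable)
    show "v \<in> limiting_gradients \<Omega> f x"
      unfolding limiting_gradients_def
    proof (intro CollectI allI impI)
      fix e :: real assume "e > 0"
      then obtain w where w: "w \<in> limiting_gradients \<Omega> f x" "dist w v < e/2"
        using v half_gt_zero by blast
      then obtain u g where "u \<in> \<Omega>" "GDERIV f u :> g" "dist u x < e/2" "dist g w < e/2"
        using \<open>e > 0\<close> unfolding limiting_gradients_def by (auto dest: spec[of _ "e/2"])
      then show "\<exists>u\<in>\<Omega>. \<exists>g. GDERIV f u :> g \<and> dist u x < e \<and> dist g v < e"
        using w \<open>e > 0\<close> dist_triangle[of g v w] by (intro bexI[of _ u] exI[of _ g]) auto
    qed
  qed
  ultimately show ?thesis by (simp add: compact_eq_bounded_closed)
qed

text \<open>In finite dimension the convex hull of a compact set is compact.\<close>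

lemma compact_clarke_subdifferential:
  "locally_lipschitz f \<Longrightarrow> compact (clarke_subdifferential \<Omega> f x)"
  unfolding clarke_subdifferential_eq_hull
  by (intro compact_convex_hull compact_limiting_gradients)

text \<open>Gradients at points approaching \<open>x\<close> are eventually bounded by a local
  Lipschitz constant. If they stayed \<open>e\<close> away from the limiting gradients, a convergent
  subsequence would nevertheless produce one.\<close>

lemma gradients_near_limiting_gradients:
  fixes f :: "'a::euclidean_space \<Rightarrow> real"
  assumes "locally_lipschitz f" "e > 0"
  obtains d where "d > 0"
    "\<And>u g. u \<in> \<Omega> \<Longrightarrow> GDERIV f u :> g \<Longrightarrow> dist u x < d \<Longrightarrow> \<exists>v\<in>limiting_gradients \<Omega> f x. dist g v < e"
proof (rule ccontr)
  assume no: "\<not> thesis"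
  obtain U L where UL: "open U" "x \<in> U" "L-lipschitz_on U f"
    using assms unfolding locally_lipschitz_def by blast
  have "\<forall>i::nat. \<exists>u g. u \<in> \<Omega> \<and> GDERIV f u :> g \<and> dist u x < inverse (real (Suc i)) \<and>
     (\<forall>v\<in>limiting_gradients \<Omega> f x. \<not> dist g v < e)"
  proof
    fix i :: nat
    show "\<exists>u g. u \<in> \<Omega> \<and> GDERIV f u :> g \<and> dist u x < inverse (real (Suc i)) \<and>
     (\<forall>v\<in>limiting_gradients \<Omega> f x. \<not> dist g v < e)"
      using no that[of "inverse (real (Suc i))"] by auto
  qed
  then obtain u g where ug: "\<And>i::nat. u i \<in> \<Omega>" "\<And>i. GDERIV f (u i) :> g i"
      "\<And>i. dist (u i) x < inverse (real (Suc i))"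
      and far: "\<And>i v. v \<in> limiting_gradients \<Omega> f x \<Longrightarrow> \<not> dist (g i) v < e"
    by metis
  have ux: "u \<longlonglongrightarrow> x"
    using ug(3) by (rule LIMSEQ_if_dist_less_inverse)
  then have "\<forall>\<^sub>F i in sequentially. u i \<in> U" using UL by (intro topological_tendstoD)
  then obtain N where N: "\<And>i. i \<ge> N \<Longrightarrow> u i \<in> U" unfolding eventually_sequentially by blast
  have "g (i + N) \<in> cball 0 L" for i
    using norm_gradient_le_lipschitz[OF UL(3,1) N ug(2)] by simp
  then obtain v r where r: "strict_mono r" "((\<lambda>i. g (i + N)) \<circ> r) \<longlonglongrightarrow> v"
    using compact_cball[of 0 L] unfolding compact_def by metis
  have rinf: "filterlim (\<lambda>i. r i + N) at_top sequentially"
    using filterlim_subseq[OF r(1)] by (rule filterlim_at_top_mono) (auto intro: always_eventually)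
  have "v \<in> limiting_gradients \<Omega> f x"
    unfolding limiting_gradients_def
  proof (intro CollectI allI impI)
    fix d :: real assume "d > 0"
    then have "\<forall>\<^sub>F i in sequentially. dist (u (r i + N)) x < d \<and> dist (g (r i + N)) v < d"
      using filterlim_compose[OF ux rinf] r(2) by (intro eventually_conj tendstoD) (auto simp: o_def)
    then obtain i where "dist (u (r i + N)) x < d \<and> dist (g (r i + N)) v < d"
      using eventually_happens sequentially_bot by blast
    then show "\<exists>u\<in>\<Omega>. \<exists>g. GDERIV f u :> g \<and> dist u x < d \<and> dist g v < d"
      using ug by blast
  qed
  moreover have "\<forall>\<^sub>F i in sequentially. dist (g (r i + N)) v < e"
    using r(2) assms(2) by (intro tendstoD) (auto simp: o_def)
  ultimately show False using far eventually_happens sequentially_bot by blast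
qed

text \<open>The enlarged set is convex, so only the limiting gradients at \<open>y\<close> have to
  be placed in it. Each is near a gradient at a point close to \<open>y\<close>, hence close to
  \<open>x\<close>.\<close>

lemma clarke_subdifferential_outer_semicontinuous:
  fixes f :: "'a::euclidean_space \<Rightarrow> real"
  assumes "locally_lipschitz f" "e > 0"
  shows "\<exists>d>0. \<forall>y. dist y x < d \<longrightarrow>
    clarke_subdifferential \<Omega> f y \<subseteq> {v + w |v w. v \<in> clarke_subdifferential \<Omega> f x \<and> w \<in> cball 0 e}"
proof -
  obtain d where d: "d > 0"
    "\<And>u g. u \<in> \<Omega> \<Longrightarrow> GDERIV f u :> g \<Longrightarrow> dist u x < d \<Longrightarrow> \<exists>v\<in>limiting_gradients \<Omega> f x. dist g v < e/2"
    using gradients_near_limiting_gradients[OF assms(1), of "e/2"] assms(2) by (metis half_gt_zero)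
  let ?E = "{v + w |v w. v \<in> clarke_subdifferential \<Omega> f x \<and> w \<in> cball 0 e}"
  have "convex ?E"
  proof -
    have "?E = (\<Union>v\<in>clarke_subdifferential \<Omega> f x. \<Union>w\<in>cball 0 e. {v + w})" by blast
    then show ?thesis
      using convex_sums[of "clarke_subdifferential \<Omega> f x" "cball 0 e"]
      by (simp add: clarke_subdifferential_eq_hull convex_convex_hull)
  qed
  show ?thesis
  proof (intro exI conjI allI impI)
    show "d / 2 > 0" using d by simp
    fix y assume y: "dist y x < d / 2"
    have "limiting_gradients \<Omega> f y \<subseteq> ?E"
    proof
      fix v assume v: "v \<in> limiting_gradients \<Omega> f y"
      have "min (d/2) (e/2) > 0" using d assms by simp
      with v obtain u g where u: "u \<in> \<Omega>" "GDERIV f u :> g" "dist u y < min (d/2) (e/2)" "dist g v < min (d/2) (e/2)"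
        unfolding limiting_gradients_def by blast
      have "dist u x < d" using u(3) y dist_triangle[of u x y] by auto
      then obtain v' where v': "v' \<in> limiting_gradients \<Omega> f x" "dist g v' < e/2" using d(2) u by blast
      have "dist v v' \<le> e" using v'(2) u(4) dist_triangle[of v v' g] by (simp add: dist_commute)
      then have "v - v' \<in> cball 0 e" by (simp add: dist_norm norm_minus_commute)
      moreover have "v' \<in> clarke_subdifferential \<Omega> f x"
        using v'(1) hull_subset[of "limiting_gradients \<Omega> f x" convex]
        by (auto simp: clarke_subdifferential_eq_hull)
      moreover have "v = v' + (v - v')" by simp
      ultimately show "v \<in> ?E" by blast
    qed
    then show "clarke_subdifferential \<Omega> f y \<subseteq> ?E"
      unfolding clarke_subdifferential_eq_hull[of \<Omega> f y] using \<open>convex ?E\<close> by (rule hull_minimal)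
  qed
qed

text \<open>Finitely many Lipschitz neighbourhoods cover the compact closure. The sum of their
  constants dominates each of them, and adding 1 makes the bound positive.\<close>

lemma clarke_subdifferential_bounded_on_bounded:
  fixes f :: "'a::euclidean_space \<Rightarrow> real"
  assumes "locally_lipschitz f" "bounded B"
  obtains K where "K > 0" "\<And>x v. x \<in> B \<Longrightarrow> v \<in> clarke_subdifferential \<Omega> f x \<Longrightarrow> norm v \<le> K"
proof -
  obtain U L where UL: "\<And>x. open (U x)" "\<And>x. x \<in> U x" "\<And>x. (L x)-lipschitz_on (U x) f"
    using assms unfolding locally_lipschitz_def by metis
  have comp: "compact (closure B)" using assms(2) by (simp add: compact_eq_bounded_closed bounded_closure)
  have cov: "closure B \<subseteq> (\<Union>x\<in>closure B. U x)" using UL(2) by auto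
  obtain I where I: "I \<subseteq> closure B" "finite I" "closure B \<subseteq> (\<Union>x\<in>I. U x)"
    by (rule compactE_image[OF comp UL(1) cov])
  define K where "K = 1 + (\<Sum>x\<in>I. L x)"
  have L0: "L x \<ge> 0" for x using UL(3) by (rule lipschitz_on_nonneg)
  show ?thesis
  proof
    show "K > 0" using L0 by (simp add: K_def add_pos_nonneg sum_nonneg)
    fix x v assume x: "x \<in> B" "v \<in> clarke_subdifferential \<Omega> f x"
    then obtain y where y: "y \<in> I" "x \<in> U y" using I closure_subset by blast
    have "clarke_subdifferential \<Omega> f x \<subseteq> cball 0 (L y)"
      unfolding clarke_subdifferential_eq_hull
      using norm_limiting_gradient_le_lipschitz[OF UL(3,1) y(2)]
      by (intro hull_minimal) auto
    with x have "norm v \<le> L y" by auto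
    also have "\<dots> \<le> (\<Sum>x\<in>I. L x)" using y I L0 by (intro member_le_sum) auto
    finally show "norm v \<le> K" by (simp add: K_def)
  qed
qed

section \<open>Convergence of the noise series\<close>

text \<open>Square-integrable martingale differences in tested form. \<open>orthogonal\<close> asks
  for integrability of the product only, which matches the characteristic property of
  \<open>real_cond_exp\<close>.\<close>

locale orthogonal_increments = prob_space M for M :: "'w measure" +
  fixes F :: "nat \<Rightarrow> 'w measure" and D :: "nat \<Rightarrow> 'w \<Rightarrow> real"
  assumes subalg: "\<And>n. subalgebra M (F n)"
    and subalg_Suc: "\<And>n. subalgebra (F (Suc n)) (F n)"
    and adapted: "\<And>n. D n \<in> borel_measurable (F (Suc n))"
    and sq_integrable: "\<And>n. integrable M (\<lambda>w. (D n w)\<^sup>2)"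
    and orthogonal: "\<And>n W. W \<in> borel_measurable (F n) \<Longrightarrow> integrable M (\<lambda>w. W w * D n w) \<Longrightarrow>
                       (\<integral>w. W w * D n w \<partial>M) = 0"
begin

definition partial_sum :: "nat \<Rightarrow> 'w \<Rightarrow> real" where
  "partial_sum n w = (\<Sum>i<n. D i w)"

lemma measurable_F_mono:
  assumes "m \<le> n" "g \<in> borel_measurable (F m)"
  shows "g \<in> borel_measurable (F n)"
  using assms by (induction rule: dec_induct) (auto intro: measurable_from_subalg[OF subalg_Suc])

lemma measurable_F_M: "g \<in> borel_measurable (F n) \<Longrightarrow> g \<in> borel_measurable M"
  by (rule measurable_from_subalg[OF subalg])

lemma partial_sum_measurable_F: "m \<le> n \<Longrightarrow> partial_sum m \<in> borel_measurable (F n)"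
  unfolding partial_sum_def
  by (intro borel_measurable_sum) (auto intro: measurable_F_mono[OF _ adapted] simp: Suc_le_eq)

lemma partial_sum_measurable [measurable]: "partial_sum m \<in> borel_measurable M"
  using partial_sum_measurable_F[OF order_refl] by (rule measurable_F_M)

lemma D_measurable [measurable]: "D m \<in> borel_measurable M"
  using adapted by (rule measurable_F_M)

text \<open>On the event, the stopped sum has absolute value at least \<open>\<epsilon>\<close>;
  orthogonality bounds its second moment, and Markov's inequality concludes. The finite horizon
  \<open>n\<close> and free start \<open>m\<close> prepare the passage to tails.\<close>

lemma maximal_inequality:
  assumes "\<epsilon> > 0"
  shows "prob {w \<in> space M. \<exists>k\<le>n. \<epsilon> \<le> \<bar>partial_sum (m + k) w - partial_sum m w\<bar>}
           \<le> (\<Sum>i<n. \<integral>w. (D (m + i) w)\<^sup>2 \<partial>M) / \<epsilon>\<^sup>2"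
proof -
  txt \<open>\<open>T\<close> is the sum stopped at the first exit; being predictable, \<open>good\<close> preserves orthogonality.\<close>
  define good :: "nat \<Rightarrow> 'w \<Rightarrow> real"
    where "good i w = (if \<forall>j\<in>{..i}. \<bar>partial_sum (m + j) w - partial_sum m w\<bar> < \<epsilon> then 1 else 0)" for i w
  define T where "T n w = (\<Sum>i<n. good i w * D (m + i) w)" for n w
  have good_meas: "good i \<in> borel_measurable (F (m + i))" for i
  proof -
    have [measurable]: "partial_sum (m + j) \<in> borel_measurable (F (m + i))" if "j \<in> {..i}" for j
      using that by (intro partial_sum_measurable_F) auto
    have [measurable]: "partial_sum m \<in> borel_measurable (F (m + i))"
      by (intro partial_sum_measurable_F) auto
    have "Measurable.pred (F (m + i)) (\<lambda>w. \<forall>j\<in>{..i}. \<bar>partial_sum (m + j) w - partial_sum m w\<bar> < \<epsilon>)"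
    proof (rule pred_intros_finite)
      fix j assume "j \<in> {..i}"
      then have [measurable]: "partial_sum (m + j) \<in> borel_measurable (F (m + i))"
        by (intro partial_sum_measurable_F) auto
      show "Measurable.pred (F (m + i)) (\<lambda>w. \<bar>partial_sum (m + j) w - partial_sum m w\<bar> < \<epsilon>)" by measurable
    qed simp
    then show ?thesis unfolding good_def by measurable
  qed
  have [measurable]: "good i \<in> borel_measurable M" for i
    using good_meas by (rule measurable_F_M)
  have good_01: "good i w = 0 \<or> good i w = 1" for i w by (simp add: good_def)
  have T_meas: "T n \<in> borel_measurable (F (m + n))" for n
    unfolding T_def
  proof (intro borel_measurable_sum borel_measurable_times)
    fix i assume "i \<in> {..<n}"
    then show "good i \<in> borel_measurable (F (m + n))" "D (m + i) \<in> borel_measurable (F (m + n))"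
      using measurable_F_mono[OF _ good_meas] measurable_F_mono[OF _ adapted] by auto
  qed
  have [measurable]: "T n \<in> borel_measurable M" for n
    using T_meas by (rule measurable_F_M)
  have T_sq: "integrable M (\<lambda>w. (T n w)\<^sup>2) \<and>
     (\<integral>w. (T n w)\<^sup>2 \<partial>M) \<le> (\<Sum>i<n. \<integral>w. (D (m + i) w)\<^sup>2 \<partial>M)" for n
  proof (induction n)
    case 0
    then show ?case by (simp add: T_def)
  next
    case (Suc n)
    let ?W = "\<lambda>w. T n w * good n w"
    \<comment> \<open>The bound \<open>2ab <= a^2 + b^2\<close> makes the mixed product integrable,
      as \<open>orthogonal\<close> requires.\<close>
    have W: "integrable M (\<lambda>w. ?W w * D (m + n) w)"
    proof (rule Bochner_Integration.integrable_bound)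
      show "integrable M (\<lambda>w. (T n w)\<^sup>2 + (D (m + n) w)\<^sup>2)"
        using Suc.IH sq_integrable by (intro Bochner_Integration.integrable_add) auto
      show "AE w in M. norm (?W w * D (m + n) w) \<le> norm ((T n w)\<^sup>2 + (D (m + n) w)\<^sup>2)"
      proof (rule AE_I2)
        fix w
        have "2 * (\<bar>T n w\<bar> * \<bar>D (m + n) w\<bar>) \<le> (T n w)\<^sup>2 + (D (m + n) w)\<^sup>2"
          using sum_squares_bound[of "\<bar>T n w\<bar>" "\<bar>D (m + n) w\<bar>"] by (simp add: mult.assoc)
        moreover have "0 \<le> \<bar>T n w\<bar> * \<bar>D (m + n) w\<bar>" by simp
        ultimately have "\<bar>T n w\<bar> * \<bar>D (m + n) w\<bar> \<le> (T n w)\<^sup>2 + (D (m + n) w)\<^sup>2" by linarith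
        then show "norm (?W w * D (m + n) w) \<le> norm ((T n w)\<^sup>2 + (D (m + n) w)\<^sup>2)"
          using good_01[of n w] by (auto simp: abs_mult)
      qed
    qed measurable
    have D2: "integrable M (\<lambda>w. good n w * (D (m + n) w)\<^sup>2)"
    proof (rule Bochner_Integration.integrable_bound[OF sq_integrable[of "m + n"]])
      show "AE w in M. norm (good n w * (D (m + n) w)\<^sup>2) \<le> norm ((D (m + n) w)\<^sup>2)"
      proof (rule AE_I2)
        fix w
        show "norm (good n w * (D (m + n) w)\<^sup>2) \<le> norm ((D (m + n) w)\<^sup>2)"
          using good_01[of n w] by auto
      qed
    qed measurable
    have "?W \<in> borel_measurable (F (m + n))"
      using T_meas good_meas by (intro borel_measurable_times)
    then have W0: "(\<integral>w. ?W w * D (m + n) w \<partial>M) = 0"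
      using W by (rule orthogonal)
    \<comment> \<open>\<open>good n\<close> takes only the values 0 and 1, so it equals its
      square.\<close>
    have eq: "(T (Suc n) w)\<^sup>2 = (T n w)\<^sup>2 + 2 * (?W w * D (m + n) w) + good n w * (D (m + n) w)\<^sup>2" for w
      using good_01[of n w] by (auto simp: T_def power2_eq_square algebra_simps)
    have "integrable M (\<lambda>w. (T (Suc n) w)\<^sup>2)"
      unfolding eq using Suc.IH W D2 by (intro Bochner_Integration.integrable_add integrable_mult_right) auto
    moreover have "(\<integral>w. (T (Suc n) w)\<^sup>2 \<partial>M)
        = (\<integral>w. (T n w)\<^sup>2 \<partial>M) + (\<integral>w. good n w * (D (m + n) w)\<^sup>2 \<partial>M)"
      unfolding eq using Suc.IH W D2 W0 by simp
    moreover have "(\<integral>w. good n w * (D (m + n) w)\<^sup>2 \<partial>M) \<le> (\<integral>w. (D (m + n) w)\<^sup>2 \<partial>M)"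
    proof (intro integral_mono D2 sq_integrable)
      fix w
      show "good n w * (D (m + n) w)\<^sup>2 \<le> (D (m + n) w)\<^sup>2" using good_01[of n w] by auto
    qed
    ultimately show ?case using Suc.IH by simp
  qed
  have hit: "\<epsilon> \<le> \<bar>T n w\<bar>" if ex: "\<exists>k\<le>n. \<epsilon> \<le> \<bar>partial_sum (m + k) w - partial_sum m w\<bar>" for w
  proof -
    let ?P = "\<lambda>k. \<epsilon> \<le> \<bar>partial_sum (m + k) w - partial_sum m w\<bar>"
    define k where "k = (LEAST k. ?P k)"
    have k: "?P k" "k \<le> n" and least: "\<And>j. j < k \<Longrightarrow> \<not> ?P j"
      using ex LeastI[of ?P] Least_le[of ?P] not_less_Least[of _ ?P] unfolding k_def
      by (auto intro: order_trans)
    \<comment> \<open>\<open>good i\<close> is 1 for \<open>i < k\<close> and 0 from the first exit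
      \<open>k\<close> on, so the sum freezes at \<open>k\<close>.\<close>
    have "T n w = (\<Sum>i<k. good i w * D (m + i) w)"
      unfolding T_def
    proof (rule sum.mono_neutral_right)
      show "\<forall>i\<in>{..<n} - {..<k}. good i w * D (m + i) w = 0"
        using k(1) by (auto simp: good_def not_less dest!: bspec[of _ _ k])
    qed (use k in auto)
    also have "\<dots> = (\<Sum>i<k. D (m + i) w)"
      using least by (intro sum.cong) (auto simp: good_def not_le)
    also have "\<dots> = partial_sum (m + k) w - partial_sum m w"
      by (induction k) (auto simp: partial_sum_def)
    finally show ?thesis using k(1) by simp
  qed
  have "prob {w \<in> space M. \<exists>k\<le>n. \<epsilon> \<le> \<bar>partial_sum (m + k) w - partial_sum m w\<bar>} \<le> prob {w \<in> space M. \<epsilon>\<^sup>2 \<le> (T n w)\<^sup>2}"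
  proof (rule finite_measure_mono)
    show "{w \<in> space M. \<exists>k\<le>n. \<epsilon> \<le> \<bar>partial_sum (m + k) w - partial_sum m w\<bar>} \<subseteq> {w \<in> space M. \<epsilon>\<^sup>2 \<le> (T n w)\<^sup>2}"
      using hit assms by (force simp: abs_le_square_iff[symmetric])
  qed measurable
  also have "\<dots> \<le> (\<integral>w. (T n w)\<^sup>2 \<partial>M) / \<epsilon>\<^sup>2"
    using T_sq[of n] assms by (intro integral_Markov_inequality_measure[where A = "{}"]) auto
  also have "\<dots> \<le> (\<Sum>i<n. \<integral>w. (D (m + i) w)\<^sup>2 \<partial>M) / \<epsilon>\<^sup>2"
    using T_sq[of n] by (intro divide_right_mono) auto
  finally show ?thesis .
qed

text \<open>As \<open>n\<close> grows, the maximal inequality bounds the probability of ever moving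
  \<open>\<epsilon>\<close> away from the sum at \<open>m\<close> by a tail divided by
  \<open>\<epsilon>\<^sup>2\<close>. Such moves for every \<open>m\<close> thus form a null event,
  and countably many \<open>\<epsilon>\<close> give the Cauchy property.\<close>

lemma AE_convergent:
  assumes summable: "summable (\<lambda>i. \<integral>w. (D i w)\<^sup>2 \<partial>M)"
  shows "AE w in M. convergent (\<lambda>n. partial_sum n w)"
proof -
  let ?a = "\<lambda>i. \<integral>w. (D i w)\<^sup>2 \<partial>M"
  have tail: "(\<lambda>m. \<Sum>i. ?a (i + m)) \<longlonglongrightarrow> 0"
    using summable by (rule suminf_exist_split2)
  have "AE w in M. \<exists>m. \<forall>k. \<bar>partial_sum (m + k) w - partial_sum m w\<bar> < \<epsilon>" if "\<epsilon> > 0" for \<epsilon>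
  proof -
    define B where "B m n = {w \<in> space M. \<exists>k\<le>n. \<epsilon> \<le> \<bar>partial_sum (m + k) w - partial_sum m w\<bar>}" for m n
    have [measurable]: "B m n \<in> sets M" for m n unfolding B_def by measurable
    have B_le: "prob (\<Union>n. B m n) \<le> (\<Sum>i. ?a (i + m)) / \<epsilon>\<^sup>2" for m
    proof (rule LIMSEQ_le_const2)
      show "(\<lambda>n. prob (B m n)) \<longlonglongrightarrow> prob (\<Union>n. B m n)"
        by (rule finite_Lim_measure_incseq) (auto simp: incseq_def B_def intro: order_trans)
      show "\<exists>N. \<forall>n\<ge>N. prob (B m n) \<le> (\<Sum>i. ?a (i + m)) / \<epsilon>\<^sup>2"
      proof (intro exI allI impI)
        fix n
        have "prob (B m n) \<le> (\<Sum>i<n. ?a (m + i)) / \<epsilon>\<^sup>2"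
          unfolding B_def using \<open>\<epsilon> > 0\<close> by (rule maximal_inequality)
        also have "\<dots> \<le> (\<Sum>i. ?a (i + m)) / \<epsilon>\<^sup>2"
          using summable by (intro divide_right_mono) 
            (auto simp: add.commute intro!: sum_le_suminf summable_ignore_initial_segment)
        finally show "prob (B m n) \<le> (\<Sum>i. ?a (i + m)) / \<epsilon>\<^sup>2" .
      qed
    qed
    define N where "N = (\<Inter>m. \<Union>n. B m n)"
    have [measurable]: "N \<in> sets M" unfolding N_def by measurable
    have "prob N \<le> (\<Sum>i. ?a (i + m)) / \<epsilon>\<^sup>2" for m
      by (rule order_trans[OF finite_measure_mono B_le[of m]]) (auto simp: N_def)
    moreover have "(\<lambda>m. (\<Sum>i. ?a (i + m)) / \<epsilon>\<^sup>2) \<longlonglongrightarrow> 0"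
      using tendsto_divide[OF tail tendsto_const[of "\<epsilon>\<^sup>2"]] \<open>\<epsilon> > 0\<close> by simp
    ultimately have "prob N \<le> 0"
      by (intro LIMSEQ_le_const) auto
    then have "prob N = 0" using measure_nonneg[of M N] by linarith
    then have "N \<in> null_sets M" by (simp add: null_sets_def emeasure_eq_measure)
    then have "AE w in M. w \<notin> N" by (rule AE_not_in)
    moreover have "AE w in M. w \<in> space M" by simp
    ultimately show ?thesis
    proof eventually_elim
      case (elim w)
      then obtain m where "\<And>n. w \<notin> B m n" by (auto simp: N_def)
      then show ?case using elim by (auto simp: B_def not_le intro!: exI[of _ m])
    qed
  qed
  then have "AE w in M. \<forall>j. \<exists>m. \<forall>k. \<bar>partial_sum (m + k) w - partial_sum m w\<bar> < inverse (real (Suc j))"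
    unfolding AE_all_countable by simp
  then show ?thesis
  proof eventually_elim
    case (elim w)
    have "Cauchy (\<lambda>n. partial_sum n w)"
      unfolding Cauchy_altdef
    proof (intro allI impI)
      fix e :: real assume "e > 0"
      then obtain j where j: "inverse (real (Suc j)) < e / 2" using reals_Archimedean half_gt_zero by blast
      obtain m where m: "\<And>k. \<bar>partial_sum (m + k) w - partial_sum m w\<bar> < inverse (real (Suc j))" using elim by blast
      have "dist (partial_sum p w) (partial_sum q w) < e" if "p \<ge> m" "q > p" for p q
        using m[of "p - m"] m[of "q - m"] that j by (auto simp: dist_real_def)
      then show "\<exists>M. \<forall>p\<ge>M. \<forall>n>p. dist (partial_sum p w) (partial_sum n w) < e" by blast
    qed
    then show ?case by (rule Cauchy_convergent)
  qed
qed

end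

section \<open>The history filtration and the truncated noise\<close>

lemma space_history [simp]: "space (history M x y \<xi> k) = space M"
  unfolding history_def by (rule space_measure_of) auto

lemma sets_history:
  "sets (history M x y \<xi> k) = sigma_sets (space M)
     ({x j -` B \<inter> space M | j B. 1 \<le> j \<and> j \<le> k \<and> B \<in> sets borel} \<union>
      {y j -` B \<inter> space M | j B. 1 \<le> j \<and> j \<le> k \<and> B \<in> sets borel} \<union>
      {\<xi> i -` B \<inter> space M | i B. 1 \<le> i \<and> i < k \<and> B \<in> sets borel})"
  unfolding history_def by (rule sets_measure_of) auto

lemma subalgebra_history:
  assumes "\<And>k. k \<ge> 1 \<Longrightarrow> x k \<in> borel_measurable M"
    and "\<And>k. k \<ge> 1 \<Longrightarrow> y k \<in> borel_measurable M"
    and "\<And>k. k \<ge> 1 \<Longrightarrow> \<xi> k \<in> borel_measurable M"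
  shows "subalgebra M (history M x y \<xi> k)"
  unfolding subalgebra_def sets_history
  using assms by (auto intro!: sets.sigma_sets_subset measurable_sets)

lemma subalgebra_history_Suc:
  "subalgebra (history M x y \<xi> (Suc k)) (history M x y \<xi> k)"
  unfolding subalgebra_def sets_history
  by (auto intro!: sigma_sets_mono') (metis le_SucI less_SucI)+

lemma measurable_history_iterate:
  assumes "1 \<le> j" "j \<le> k"
  shows "x j \<in> borel_measurable (history M x y \<xi> k)"
  using assms by (intro measurableI) (auto simp: sets_history intro!: sigma_sets.Basic)

lemma measurable_history_noise:
  assumes "1 \<le> i" "i < k"
  shows "\<xi> i \<in> borel_measurable (history M x y \<xi> k)"
  using assms by (intro measurableI) (auto simp: sets_history intro!: sigma_sets.Basic)

text \<open>On a ball \<open>p\<close> is bounded, so noise truncated to iterates in that ball has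
  uniformly bounded second moments. The squared weights then give a summable series for each radius
  and component.\<close>

lemma AE_convergent_weighted_noise:
  fixes x y \<xi> :: "nat \<Rightarrow> 'w \<Rightarrow> 'a::euclidean_space" and \<alpha> :: "nat \<Rightarrow> real" and p :: "'a \<Rightarrow> real"
  assumes "prob_space M"
    and meas: "\<And>k. k \<ge> 1 \<Longrightarrow> x k \<in> borel_measurable M"
      "\<And>k. k \<ge> 1 \<Longrightarrow> y k \<in> borel_measurable M"
      "\<And>k. k \<ge> 1 \<Longrightarrow> \<xi> k \<in> borel_measurable M"
    and summable: "summable (\<lambda>k. (\<alpha> (Suc k))\<^sup>2)"
    and bounded_iterates: "AE \<omega> in M. bdd_above ((\<lambda>k. norm (x k \<omega>)) ` {1..})"
    and p: "\<And>B. bounded B \<Longrightarrow> bounded (p ` B)"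
    and noise: "AE \<omega> in M. \<forall>k\<ge>1.
          vec_cond_exp M (history M x y \<xi> k) (\<xi> k) \<omega> = 0 \<and>
          nn_cond_exp M (history M x y \<xi> k) (\<lambda>\<omega>'. ennreal ((norm (\<xi> k \<omega>'))\<^sup>2)) \<omega>
            \<le> ennreal (p (x k \<omega>))"
  shows "AE \<omega> in M. convergent (\<lambda>n. \<Sum>k<n. \<alpha> (Suc k) *\<^sub>R \<xi> (Suc k) \<omega>)"
proof -
  interpret prob_space M by fact
  \<comment> \<open>Iterates are numbered from 1: \<open>?F n\<close> knows the iterate
    \<open>Suc n\<close> but the noise only up to index \<open>n\<close>, so \<open>D R b n\<close>
    becomes measurable one step later.\<close>
  let ?F = "\<lambda>n. history M x y \<xi> (Suc n)"
  define in_ball :: "nat \<Rightarrow> nat \<Rightarrow> 'w \<Rightarrow> real"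
    where "in_ball R n w = (if norm (x (Suc n) w) \<le> real R then 1 else 0)" for R n w
  define D where "D R b n w = \<alpha> (Suc n) * in_ball R n w * (\<xi> (Suc n) w \<bullet> b)" for R b n w
  have subalg: "subalgebra M (?F n)" for n
    using meas by (rule subalgebra_history)
  have cond: "sigma_finite_subalgebra M (?F n)" for n
    by (intro finite_measure_subalgebra_is_sigma_finite
        finite_measure_subalgebra.intro finite_measure_subalgebra_axioms.intro subalg) unfold_locales
  have [measurable]: "x (Suc n) \<in> borel_measurable M" "\<xi> (Suc n) \<in> borel_measurable M" for n
    using meas by auto
  have [measurable]: "in_ball R n \<in> borel_measurable (?F m)" if "n \<le> m" for R n m
  proof -
    have [measurable]: "x (Suc n) \<in> borel_measurable (?F m)"
      using that by (intro measurable_history_iterate) auto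
    show ?thesis unfolding in_ball_def by measurable
  qed
  have [measurable]: "in_ball R n \<in> borel_measurable M" for R n
    unfolding in_ball_def by measurable
  have in_ball_01: "in_ball R n w = 0 \<or> in_ball R n w = 1" for R n w
    by (simp add: in_ball_def indicator_def)
  have "AE w in M. convergent (\<lambda>n. \<Sum>i<n. D R b i w)" if b: "b \<in> Basis" for R b
  proof -
    obtain P0 where "\<forall>v\<in>p ` cball 0 (real R). norm v \<le> P0"
      using p[OF bounded_cball[of 0 "real R"]] unfolding bounded_iff by blast
    then have P0: "\<And>u. u \<in> cball 0 (real R) \<Longrightarrow> p u \<le> \<bar>P0\<bar>" by force
    define P where "P = \<bar>P0\<bar>"
    have P: "P \<ge> 0" "\<And>u. u \<in> cball 0 (real R) \<Longrightarrow> p u \<le> P" using P0 by (auto simp: P_def)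
    have moment: "(\<integral>\<^sup>+ w. ennreal ((in_ball R n w * (\<xi> (Suc n) w \<bullet> b))\<^sup>2) \<partial>M) \<le> ennreal P" for n
    proof -
      have "(\<integral>\<^sup>+ w. ennreal ((in_ball R n w * (\<xi> (Suc n) w \<bullet> b))\<^sup>2) \<partial>M)
          \<le> (\<integral>\<^sup>+ w. ennreal (in_ball R n w) * ennreal ((norm (\<xi> (Suc n) w))\<^sup>2) \<partial>M)"
      proof (rule nn_integral_mono)
        fix w
        have "\<bar>\<xi> (Suc n) w \<bullet> b\<bar>\<^sup>2 \<le> (norm (\<xi> (Suc n) w))\<^sup>2"
          using b by (intro power_mono Basis_le_norm) auto
        then show "ennreal ((in_ball R n w * (\<xi> (Suc n) w \<bullet> b))\<^sup>2)
            \<le> ennreal (in_ball R n w) * ennreal ((norm (\<xi> (Suc n) w))\<^sup>2)"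
          using in_ball_01[of R n w] by (auto intro: ennreal_leI)
      qed
      \<comment> \<open>The truncation is known to the history, so under the integral the squared
        norm may be exchanged for its conditional expectation.\<close>
      also have "\<dots> = (\<integral>\<^sup>+ w. ennreal (in_ball R n w) *
           nn_cond_exp M (?F n) (\<lambda>w. ennreal ((norm (\<xi> (Suc n) w))\<^sup>2)) w \<partial>M)"
        by (rule sigma_finite_subalgebra.nn_cond_exp_intg[OF cond, symmetric]) auto
      also have "\<dots> \<le> (\<integral>\<^sup>+ w. ennreal P \<partial>M)"
      proof (rule nn_integral_mono_AE)
        show "AE w in M. ennreal (in_ball R n w) *
           nn_cond_exp M (?F n) (\<lambda>w. ennreal ((norm (\<xi> (Suc n) w))\<^sup>2)) w \<le> ennreal P"
          using noise
        proof eventually_elim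
          case (elim w)
          then have "nn_cond_exp M (?F n) (\<lambda>w. ennreal ((norm (\<xi> (Suc n) w))\<^sup>2)) w \<le> ennreal (p (x (Suc n) w))"
            by simp
          moreover have "in_ball R n w = 1 \<Longrightarrow> ennreal (p (x (Suc n) w)) \<le> ennreal P"
            using P by (intro ennreal_leI) (auto simp: in_ball_def split: if_splits)
          ultimately show ?case using in_ball_01[of R n w] by auto
        qed
      qed
      also have "\<dots> = ennreal P" by (simp add: emeasure_space_1)
      finally show ?thesis .
    qed
    have sq: "integrable M (\<lambda>w. (in_ball R n w * (\<xi> (Suc n) w \<bullet> b))\<^sup>2)" for n
      by (rule integrableI_bounded)
         (use moment[of n] in \<open>auto intro: le_less_trans\<close>)
    have sq_le: "(\<integral>w. (in_ball R n w * (\<xi> (Suc n) w \<bullet> b))\<^sup>2 \<partial>M) \<le> P" for n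
      using moment[of n] P by (subst integral_eq_nn_integral) (auto intro: enn2real_leI)
    have D_sq: "(D R b n w)\<^sup>2 = (\<alpha> (Suc n))\<^sup>2 * (in_ball R n w * (\<xi> (Suc n) w \<bullet> b))\<^sup>2" for n w
      by (simp add: D_def power_mult_distrib mult.assoc)
    interpret orthogonal_increments M ?F "D R b"
    proof
      show "subalgebra M (?F n)" for n by fact
      show "subalgebra (?F (Suc n)) (?F n)" for n by (rule subalgebra_history_Suc)
      show "D R b n \<in> borel_measurable (?F (Suc n))" for n
      proof -
        have [measurable]: "\<xi> (Suc n) \<in> borel_measurable (?F (Suc n))"
          by (intro measurable_history_noise) auto
        show ?thesis unfolding D_def by measurable
      qed
      show "integrable M (\<lambda>w. (D R b n w)\<^sup>2)" for n
        unfolding D_sq using sq by (rule integrable_mult_right)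
      fix n W assume W [measurable]: "W \<in> borel_measurable (?F n)" and int: "integrable M (\<lambda>w. W w * D R b n w)"
      let ?V = "\<lambda>w. W w * \<alpha> (Suc n) * in_ball R n w"
      have V: "?V \<in> borel_measurable (?F n)" by measurable
      have eq: "W w * D R b n w = ?V w * (\<xi> (Suc n) w \<bullet> b)" for w by (simp add: D_def)
      \<comment> \<open>Only the product with the weight has to be integrable; the noise component
        alone may fail to be.\<close>
      have "(\<integral>w. W w * D R b n w \<partial>M) = (\<integral>w. ?V w * real_cond_exp M (?F n) (\<lambda>w. \<xi> (Suc n) w \<bullet> b) w \<partial>M)"
        unfolding eq
        by (rule sigma_finite_subalgebra.real_cond_exp_intg(2)[OF cond, symmetric])
           (use int V in \<open>auto simp: eq\<close>)
      also have "\<dots> = (\<integral>w. 0 \<partial>M)"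
      proof (rule integral_cong_AE)
        show "AE w in M. ?V w * real_cond_exp M (?F n) (\<lambda>w. \<xi> (Suc n) w \<bullet> b) w = 0"
          using noise
        proof eventually_elim
          case (elim w)
          then have "vec_cond_exp M (?F n) (\<xi> (Suc n)) w \<bullet> b = 0" by simp
          then have "real_cond_exp M (?F n) (\<lambda>w. \<xi> (Suc n) w \<bullet> b) w = 0"
            using b by (simp add: vec_cond_exp_def inner_sum_left_Basis)
          then show ?case by simp
        qed
      qed (use measurable_from_subalg[OF subalg V] in auto)
      finally show "(\<integral>w. W w * D R b n w \<partial>M) = 0" by simp
    qed
    have "summable (\<lambda>i. \<integral>w. (D R b i w)\<^sup>2 \<partial>M)"
    proof (rule summable_comparison_test')
      show "summable (\<lambda>n. (\<alpha> (Suc n))\<^sup>2 * P)" using summable by (rule summable_mult2)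
      show "norm (\<integral>w. (D R b n w)\<^sup>2 \<partial>M) \<le> (\<alpha> (Suc n))\<^sup>2 * P" if "n \<ge> 0" for n
        unfolding D_sq using sq_le[of n] by (simp add: mult_left_mono)
    qed
    from AE_convergent[OF this] show ?thesis by (simp add: partial_sum_def)
  qed
  then have "AE w in M. \<forall>b\<in>Basis. convergent (\<lambda>n. \<Sum>i<n. D R b i w)" for R
    by (intro AE_finite_allI) auto
  then have "AE w in M. \<forall>R. \<forall>b\<in>Basis. convergent (\<lambda>n. \<Sum>i<n. D R b i w)"
    unfolding AE_all_countable by simp
  then show ?thesis using bounded_iterates
  proof eventually_elim
    case (elim w)
    then obtain C where C: "\<And>k. k \<ge> 1 \<Longrightarrow> norm (x k w) \<le> C"
      by (auto simp: bdd_above_def)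
    \<comment> \<open>A bounded path stays in a ball of natural radius, where the truncation is
      never active.\<close>
    obtain R :: nat where R: "C \<le> real R" using real_arch_simple by blast
    have "in_ball R n w = 1" for n
      using order_trans[OF C R, of "Suc n"] by (simp add: in_ball_def)
    then have D: "D R b n w = \<alpha> (Suc n) * (\<xi> (Suc n) w \<bullet> b)" for b n by (simp add: D_def)
    have "\<forall>b\<in>Basis. \<exists>l. (\<lambda>n. \<Sum>i<n. D R b i w) \<longlonglongrightarrow> l"
      using elim(1) by (auto simp: convergent_def)
    then obtain l where l: "\<And>b. b \<in> Basis \<Longrightarrow> (\<lambda>n. \<Sum>i<n. D R b i w) \<longlonglongrightarrow> l b" by metis
    have "(\<lambda>n. \<Sum>k<n. \<alpha> (Suc k) *\<^sub>R \<xi> (Suc k) w) \<longlonglongrightarrow> (\<Sum>b\<in>Basis. l b *\<^sub>R b)"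
    proof (subst tendsto_componentwise_iff, intro ballI)
      fix b :: 'a assume b: "b \<in> Basis"
      then have "(\<Sum>b\<in>Basis. l b *\<^sub>R b) \<bullet> b = l b" by simp
      then show "(\<lambda>n. (\<Sum>k<n. \<alpha> (Suc k) *\<^sub>R \<xi> (Suc k) w) \<bullet> b) \<longlonglongrightarrow> (\<Sum>b\<in>Basis. l b *\<^sub>R b) \<bullet> b"
        using l[OF b] by (simp only: inner_sum_left[of _ "{..<_}"] D inner_scaleR_left)
    qed
    then show ?case by (auto simp: convergent_def)
  qed
qed

section \<open>Limits of the noise-free recursion\<close>

text \<open>\<open>x\<close> are the iterates and \<open>u\<close> the iterates corrected by the tail of the noise series. Steps of
  length \<open>0\<close> are allowed, so \<open>time\<close> need not be strictly increasing.\<close>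

locale subgradient_recursion =
  fixes f :: "'a::euclidean_space \<Rightarrow> real" and \<Omega> :: "'a set"
    and \<alpha> :: "nat \<Rightarrow> real" and x u y :: "nat \<Rightarrow> 'a"
  assumes lipschitz: "locally_lipschitz f"
    and alpha_nonneg: "\<And>k. 0 \<le> \<alpha> k"
    and alpha_null: "\<alpha> \<longlonglongrightarrow> 0"
    and alpha_diverges: "filterlim (\<lambda>n. \<Sum>k<n. \<alpha> k) at_top sequentially"
    and step: "\<And>k. u (Suc k) = u k - \<alpha> k *\<^sub>R y k"
    and close: "(\<lambda>k. x k - u k) \<longlonglongrightarrow> 0"
    and subgradient: "\<And>k. y k \<in> clarke_subdifferential \<Omega> f (x k)"
    and bounded: "bounded (range x)"
begin

section \<open>The time scale and the speed of the recursion\<close>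

definition time :: "nat \<Rightarrow> real" where
  "time n = (\<Sum>k<n. \<alpha> k)"

text \<open>Sampling at \<open>idx\<close> is a piecewise constant interpolation. Taking the least
  index limits the overshoot beyond \<open>s\<close> to one step.\<close>

definition idx :: "real \<Rightarrow> nat" where
  "idx s = (LEAST k. s \<le> time k)"

lemma time_Suc: "time (Suc n) = time n + \<alpha> n"
  by (simp add: time_def)

lemma time_mono: "m \<le> n \<Longrightarrow> time m \<le> time n"
  by (rule lift_Suc_mono_le[of time]) (simp_all add: time_Suc alpha_nonneg)

lemma time_at_top: "filterlim time at_top sequentially"
  using alpha_diverges by (simp add: time_def[abs_def])

lemma idx: "s \<le> time (idx s)"
proof -
  have "\<forall>\<^sub>F k in sequentially. s \<le> time k"
    using time_at_top unfolding filterlim_at_top by blast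
  then obtain k where "s \<le> time k" using eventually_happens sequentially_bot by blast
  then show ?thesis unfolding idx_def by (rule LeastI)
qed

lemma less_idx: "k < idx s \<Longrightarrow> time k < s"
  unfolding idx_def using not_less_Least by (meson not_le)

lemma idx_le: "s \<le> time k \<Longrightarrow> idx s \<le> k"
  unfolding idx_def by (rule Least_le)

lemma filterlim_index:
  assumes "filterlim (\<lambda>j. time (m j)) at_top G"
  shows "filterlim m at_top G"
  unfolding filterlim_at_top
proof
  fix N
  have "\<forall>\<^sub>F j in G. time N < time (m j)"
    using assms unfolding filterlim_at_top_dense by blast
  then show "\<forall>\<^sub>F j in G. N \<le> m j"
    by (rule eventually_mono) (meson linear not_less time_mono)
qed

text \<open>The index before \<open>idx (\<tau> j)\<close> has time below \<open>\<tau> j\<close>,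
  so the overshoot is less than the last step, and steps tend to 0.\<close>

lemma time_idx_tendsto:
  assumes "filterlim \<tau> at_top G"
  shows "((\<lambda>j. time (idx (\<tau> j)) - \<tau> j) \<longlongrightarrow> 0) G"
proof (rule tendstoI)
  fix e :: real assume "e > 0"
  then have "\<forall>\<^sub>F k in sequentially. \<alpha> k < e" using alpha_null by (auto dest: order_tendstoD)
  then obtain N where N: "\<And>k. k \<ge> N \<Longrightarrow> \<alpha> k < e" unfolding eventually_sequentially by blast
  have "\<forall>\<^sub>F j in G. time N < \<tau> j" using assms unfolding filterlim_at_top_dense by blast
  then show "\<forall>\<^sub>F j in G. dist (time (idx (\<tau> j)) - \<tau> j) 0 < e"
  proof (rule eventually_mono)
    fix j assume j: "time N < \<tau> j"
    have "N < idx (\<tau> j)"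
      using idx[of "\<tau> j"] j time_mono[of "idx (\<tau> j)" N] by (cases "N < idx (\<tau> j)") auto
    then obtain k where k: "idx (\<tau> j) = Suc k" "k \<ge> N" by (cases "idx (\<tau> j)") auto
    have "time k < \<tau> j" using k by (intro less_idx) simp
    then have "time (idx (\<tau> j)) < \<tau> j + e" using N[OF k(2)] by (simp add: k time_Suc)
    then show "dist (time (idx (\<tau> j)) - \<tau> j) 0 < e" using idx[of "\<tau> j"] by (simp add: dist_real_def)
  qed
qed

lemma time_plus_at_top:
  assumes "filterlim n at_top G"
  shows "filterlim (\<lambda>j. time (n j) + s) at_top G"
  using filterlim_tendsto_add_at_top[OF tendsto_const filterlim_compose[OF time_at_top assms], of s]
  by (simp add: add.commute)

lemma time_idx_shift:
  assumes "filterlim n at_top G"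
  shows "((\<lambda>j. time (idx (time (n j) + s)) - time (n j)) \<longlongrightarrow> s) G"
proof -
  have "((\<lambda>j. time (idx (time (n j) + s)) - (time (n j) + s) + s) \<longlongrightarrow> 0 + s) G"
    by (intro tendsto_add time_idx_tendsto time_plus_at_top assms tendsto_const)
  then show ?thesis by (simp add: diff_add_eq)
qed

text \<open>The iterates are bounded, hence so are the subgradients taken there; without noise they
  alone move \<open>u\<close>.\<close>

lemma speed_bound:
  obtains K where "K > 0" "\<And>m n. norm (u m - u n) \<le> K * \<bar>time m - time n\<bar>"
proof -
  obtain K where K: "K > 0" "\<And>v w. v \<in> range x \<Longrightarrow> w \<in> clarke_subdifferential \<Omega> f v \<Longrightarrow> norm w \<le> K"
    using clarke_subdifferential_bounded_on_bounded[OF lipschitz bounded] by blast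
  have *: "norm (u m - u n) \<le> K * (time m - time n)" if "n \<le> m" for m n
    using that
  proof (induction rule: dec_induct)
    case (step m)
    have "norm (u (Suc m) - u n) \<le> norm (u m - u n) + norm (\<alpha> m *\<^sub>R y m)"
      unfolding subgradient_recursion.step[OF subgradient_recursion_axioms]
      using norm_triangle_ineq4[of "u m - u n" "\<alpha> m *\<^sub>R y m"] by (simp add: algebra_simps)
    also have "norm (\<alpha> m *\<^sub>R y m) \<le> \<alpha> m * K"
      using K(2)[OF rangeI subgradient[of m]] alpha_nonneg[of m] by (simp add: mult_left_mono)
    finally show ?case using step.IH by (simp add: time_Suc algebra_simps)
  qed simp
  have "norm (u m - u n) \<le> K * \<bar>time m - time n\<bar>" for m n
    using *[of n m] *[of m n] time_mono[of n m] time_mono[of m n]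
    by (cases "n \<le> m") (auto simp: norm_minus_commute)
  with K show ?thesis using that by blast
qed

text \<open>Dividing the weighted sum of the \<open>y k\<close> by the total weight, which is the
  elapsed time, gives a convex combination.\<close>

lemma displacement_in_convex:
  assumes "convex C" and "n < m" and "\<And>k. n \<le> k \<Longrightarrow> k < m \<Longrightarrow> y k \<in> C"
  shows "\<exists>c\<in>C. u n - u m = (time m - time n) *\<^sub>R c"
proof -
  have "Suc n \<le> m" using assms by simp
  then show ?thesis using assms(3)
  proof (induction rule: dec_induct)
    case base
    then show ?case by (intro bexI[of _ "y n"]) (auto simp: step time_Suc)
  next
    case (step m)
    then obtain c where c: "c \<in> C" "u n - u m = (time m - time n) *\<^sub>R c" by auto
    have ym: "y m \<in> C" using step by auto
    let ?s = "time m - time n"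
    have s: "?s \<ge> 0" using time_mono[of n m] step by simp
    have eq: "u n - u (Suc m) = ?s *\<^sub>R c + \<alpha> m *\<^sub>R y m"
      using c(2) subgradient_recursion.step[OF subgradient_recursion_axioms, of m] by (simp add: algebra_simps)
    show ?case
    proof (cases "?s + \<alpha> m = 0")
      \<comment> \<open>With no elapsed time to divide by, the displacement is 0 and the old average
        serves.\<close>
      case True
      then have "?s = 0" "\<alpha> m = 0" using s alpha_nonneg[of m] by auto
      then show ?thesis using eq c by (intro bexI[of _ c]) (auto simp: time_Suc)
    next
      case False
      then have pos: "?s + \<alpha> m > 0" using s alpha_nonneg[of m] by linarith
      let ?c = "(?s / (?s + \<alpha> m)) *\<^sub>R c + (\<alpha> m / (?s + \<alpha> m)) *\<^sub>R y m"
      have "?c \<in> C"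
        using c(1) ym s alpha_nonneg[of m] pos
        by (intro convexD[OF assms(1)]) (auto simp flip: add_divide_distrib)
      moreover have "(time (Suc m) - time n) *\<^sub>R ?c = ?s *\<^sub>R c + \<alpha> m *\<^sub>R y m"
        using pos by (simp add: time_Suc scaleR_add_right add_diff_eq diff_add_eq)
      ultimately show ?thesis using eq by (intro bexI[of _ ?c]) auto
    qed
  qed
qed

lemma bounded_u: "bounded (range u)"
proof -
  have "bounded (range (\<lambda>k. x k - u k))" using close by (rule convergent_imp_bounded)
  from bounded_minus_comp[OF bounded this] show ?thesis by simp
qed

lemma continuous_f: "continuous_on UNIV f"
  unfolding continuous_on_eq_continuous_at[OF open_UNIV]
proof
  fix v
  obtain U L where "open U" "v \<in> U" "L-lipschitz_on U f"
    using lipschitz unfolding locally_lipschitz_def by blast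
  then show "isCont f v"
    using lipschitz_on_continuous_on continuous_on_eq_continuous_at by blast
qed

section \<open>Limit curves and the differential inclusion\<close>

text \<open>Over \<open>[s, s + h]\<close> the iterates stay near \<open>z s\<close>, so their
  subgradients lie in the closed convex set \<open>?E\<close>. Averages stay in \<open>?E\<close>,
  and so do their limits, first in \<open>j\<close> and then as \<open>h\<close> tends to 0; finally
  \<open>e\<close> is arbitrary.\<close>

lemma derivative_in_subdifferential:
  assumes z_lim: "\<And>m s. 0 \<le> s \<Longrightarrow> (\<lambda>j. time (m j) - time (n j)) \<longlonglongrightarrow> s \<Longrightarrow> (\<lambda>j. u (m j)) \<longlonglongrightarrow> z s"
    and n: "filterlim n at_top sequentially"
    and s: "0 \<le> s" and d: "(z has_vector_derivative d) (at s)"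
  shows "- d \<in> clarke_subdifferential \<Omega> f (z s)"
proof -
  let ?C = "clarke_subdifferential \<Omega> f (z s)"
  have C: "compact ?C" using lipschitz by (rule compact_clarke_subdifferential)
  obtain K where K: "K > 0" "\<And>m n. norm (u m - u n) \<le> K * \<bar>time m - time n\<bar>"
    using speed_bound by blast
  note idx_lim = time_idx_shift[OF n]
  have "\<exists>v\<in>?C. dist v (- d) \<le> e" if "e > 0" for e
  proof -
    let ?E = "{v + w |v w. v \<in> ?C \<and> w \<in> cball 0 e}"
    have "closed ?E" using compact_sums[OF C compact_cball] by (rule compact_imp_closed)
    have "convex ?E"
    proof -
      have "?E = (\<Union>v\<in>?C. \<Union>w\<in>cball 0 e. {v + w})" by blast
      then show ?thesis
        using convex_sums[of ?C "cball 0 e"] by (simp add: clarke_subdifferential_def convex_convex_hull)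
    qed
    obtain \<delta> where \<delta>: "\<delta> > 0" "\<And>v. dist v (z s) < \<delta> \<Longrightarrow> clarke_subdifferential \<Omega> f v \<subseteq> ?E"
      using clarke_subdifferential_outer_semicontinuous[OF lipschitz \<open>e > 0\<close>, where x = "z s" and \<Omega> = \<Omega>] by blast
    \<comment> \<open>Three shares of \<open>\<delta> / 3\<close>: between \<open>x k\<close> and
      \<open>u k\<close>, for the motion of \<open>u\<close> during a time of about
      \<open>h\<close>, and between its starting point and \<open>z s\<close>.\<close>
    have "- ((z (s + h) - z s) /\<^sub>R h) \<in> ?E" if h: "h > 0" "K * h < \<delta> / 3" for h
    proof -
      let ?m = "\<lambda>j. idx (time (n j) + s)" and ?m' = "\<lambda>j. idx (time (n j) + (s + h))"
      let ?h = "\<lambda>j. time (?m' j) - time (?m j)"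
      have h_lim: "?h \<longlonglongrightarrow> h"
        using tendsto_diff[OF idx_lim[of "s + h"] idx_lim[of s]] by simp
      have u_lim: "(\<lambda>j. u (?m j)) \<longlonglongrightarrow> z s" "(\<lambda>j. u (?m' j)) \<longlonglongrightarrow> z (s + h)"
        using s h by (auto intro!: z_lim idx_lim)
      have quot: "(\<lambda>j. (u (?m j) - u (?m' j)) /\<^sub>R ?h j) \<longlonglongrightarrow> (z s - z (s + h)) /\<^sub>R h"
        using h by (intro tendsto_intros u_lim h_lim) auto
      have m_top: "filterlim ?m at_top sequentially"
        by (rule filterlim_index, rule filterlim_at_top_mono[OF time_plus_at_top[OF n, of s]]) (simp add: idx)
      have "\<forall>\<^sub>F k in sequentially. dist (x k - u k) 0 < \<delta> / 3"
        using close \<delta> by (intro tendstoD) auto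
      then obtain N where N: "\<And>k. k \<ge> N \<Longrightarrow> norm (x k - u k) < \<delta> / 3"
        unfolding eventually_sequentially by auto
      have "\<forall>\<^sub>F j in sequentially. K * ?h j < \<delta> / 3"
        using h by (intro order_tendstoD(2)[OF tendsto_mult[OF tendsto_const h_lim]]) auto
      moreover have "\<forall>\<^sub>F j in sequentially. dist (u (?m j)) (z s) < \<delta> / 3"
        using u_lim(1) \<delta> by (intro tendstoD) auto
      moreover have "\<forall>\<^sub>F j in sequentially. N \<le> ?m j"
        using m_top unfolding filterlim_at_top by blast
      moreover have "\<forall>\<^sub>F j in sequentially. 0 < ?h j"
        using h by (intro order_tendstoD(1)[OF h_lim]) auto
      ultimately have "\<forall>\<^sub>F j in sequentially. (u (?m j) - u (?m' j)) /\<^sub>R ?h j \<in> ?E"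
      proof eventually_elim
        case (elim j)
        have lt: "?m j < ?m' j"
          using elim(4) by (cases "?m j < ?m' j") (auto dest: time_mono simp: not_less)
        have "y k \<in> ?E" if k: "?m j \<le> k" "k < ?m' j" for k
        proof -
          have "norm (u k - u (?m j)) \<le> K * (time k - time (?m j))"
            using K(2)[of k "?m j"] time_mono[OF k(1)] by simp
          also have "\<dots> \<le> K * ?h j"
            using K(1) time_mono[of k "?m' j"] k by (intro mult_left_mono) auto
          finally have "norm (u k - u (?m j)) < \<delta> / 3" using elim(1) by simp
          moreover have "norm (x k - u k) < \<delta> / 3" using N elim(3) k by simp
          moreover have "dist (x k) (z s) \<le> norm (x k - u k) + norm (u k - u (?m j)) + dist (u (?m j)) (z s)"
            using dist_triangle[of "x k" "z s" "u k"] dist_triangle[of "u k" "z s" "u (?m j)"]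
            by (simp add: dist_norm)
          ultimately have "dist (x k) (z s) < \<delta>" using elim(2) by linarith
          then show ?thesis using \<delta>(2) subgradient by blast
        qed
        from displacement_in_convex[OF \<open>convex ?E\<close> lt this]
        obtain c where c: "c \<in> ?E" "u (?m j) - u (?m' j) = ?h j *\<^sub>R c" by blast
        then have "(u (?m j) - u (?m' j)) /\<^sub>R ?h j = c" using elim(4) by simp
        then show ?case using c(1) by (simp only:)
      qed
      then have "(z s - z (s + h)) /\<^sub>R h \<in> ?E"
        by (intro Lim_in_closed_set[OF \<open>closed ?E\<close> _ _ quot]) auto
      then show ?thesis by (simp add: scaleR_diff_right)
    qed
    moreover have "\<forall>\<^sub>F h in at_right 0. h > 0 \<and> K * h < \<delta> / 3"
      using K(1) \<delta>(1) by (intro eventually_at_rightI[of _ "\<delta> / (3 * K)"]) (auto simp: field_simps)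
    ultimately have "\<forall>\<^sub>F h in at_right 0. - ((z (s + h) - z s) /\<^sub>R h) \<in> ?E"
      by (auto elim: eventually_mono)
    \<comment> \<open>At \<open>s = 0\<close> the assumption \<open>z_lim\<close> reaches forward
      quotients only; they already determine \<open>d\<close>.\<close>
    moreover have "((\<lambda>h. - ((z (s + h) - z s) /\<^sub>R h)) \<longlongrightarrow> - d) (at_right 0)"
      using has_vector_derivative_quotient[OF d] at_le[of "{0<..}" UNIV]
      by (intro tendsto_minus) (auto intro: tendsto_mono)
    ultimately have "- d \<in> ?E"
      by (intro Lim_in_closed_set[OF \<open>closed ?E\<close>]) auto
    then obtain v w where "- d = v + w" "v \<in> ?C" "norm w \<le> e" by auto
    then show ?thesis by (intro bexI[of _ v]) (auto simp: dist_norm)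
  qed
  then have "- d \<in> closure ?C"
    unfolding closure_approachable by (meson field_lbound_gt_zero le_less_trans less_imp_le dense)
  then show ?thesis using C by (simp add: compact_imp_closed)
qed

text \<open>A substitute for locally uniform convergence: the sampled indices \<open>m\<close> may
  move freely as long as the elapsed time converges. The map \<open>\<sigma>\<close> admits times
  that converge only along a further subsequence, such as the ends of upcrossings.\<close>

definition limit_curve :: "(nat \<Rightarrow> nat) \<Rightarrow> (real \<Rightarrow> 'a) \<Rightarrow> bool" where
  "limit_curve n z \<longleftrightarrow> (\<forall>(\<sigma> :: nat \<Rightarrow> nat) m s. filterlim \<sigma> at_top sequentially \<longrightarrow> 0 \<le> s \<longrightarrow>
     (\<lambda>j. time (m j) - time (n (\<sigma> j))) \<longlonglongrightarrow> s \<longrightarrow> (\<lambda>j. x (m j)) \<longlonglongrightarrow> z s)"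

lemma limit_curveD:
  assumes "limit_curve n z" "filterlim \<sigma> at_top sequentially" "0 \<le> s"
    "(\<lambda>j. time (m j) - time (n (\<sigma> j))) \<longlonglongrightarrow> s"
  shows "(\<lambda>j. x (m j)) \<longlonglongrightarrow> z s"
  using assms unfolding limit_curve_def by blast

text \<open>An Arzela-Ascoli argument: a subsequence converges at the countably many rational times,
  and the speed bound \<open>K\<close> carries convergence to all times and all sampling
  sequences.\<close>

lemma limit_trajectory:
  assumes n: "filterlim n at_top sequentially"
  obtains r z where "strict_mono r" "subgradient_trajectory \<Omega> f z" "continuous_on UNIV z"
    "limit_curve (\<lambda>j. n (r j)) z"
proof -
  obtain K where K: "K > 0" "\<And>m n. norm (u m - u n) \<le> K * \<bar>time m - time n\<bar>"
    using speed_bound by blast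
  obtain B where B: "\<And>k. norm (u k) \<le> B"
    using bounded_u by (auto simp: bounded_iff)
  have "countable (\<rat> \<inter> {0..} :: real set)" by (simp add: countable_rat)
  from function_convergent_subsequence[OF this, of "\<lambda>j q. u (idx (time (n j) + q))" B]
  obtain r where r: "strict_mono r"
    and conv: "\<And>q. q \<in> \<rat> \<inter> {0..} \<Longrightarrow> \<exists>l. (\<lambda>j. u (idx (time (n (r j)) + q))) \<longlonglongrightarrow> l"
    using B by metis
  let ?n = "\<lambda>j. n (r j)" and ?m = "\<lambda>s j. idx (time (n (r j)) + s)"
  have n': "filterlim ?n at_top sequentially"
    using n filterlim_subseq[OF r] by (rule filterlim_compose)
  have tn: "filterlim (\<lambda>j. time (?n j)) at_top sequentially"
    using time_at_top n' by (rule filterlim_compose)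
  note idx_lim = time_idx_shift[OF n']
  have idx_diff: "(\<lambda>j. time (?m s j) - time (?m q j)) \<longlonglongrightarrow> s - q" for s q
    using tendsto_diff[OF idx_lim[of s] idx_lim[of q]] by simp
  have "convergent (\<lambda>j. u (?m s j))" if s: "s \<ge> 0" for s
  proof (rule Cauchy_convergent, rule metric_CauchyI)
    fix e :: real assume "e > 0"
    \<comment> \<open>Between times this close, the sampled values eventually differ by less than
      \<open>e / 3\<close>; this is used at both ends of the Cauchy estimate.\<close>
    then have "s < s + e / (3 * K)" using K by simp
    then obtain q where q: "q \<in> \<rat>" "s < q" "q < s + e / (3 * K)"
      using Rats_dense_in_real by blast
    have "(\<lambda>j. K * \<bar>time (?m s j) - time (?m q j)\<bar>) \<longlonglongrightarrow> K * \<bar>s - q\<bar>"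
      by (intro tendsto_mult tendsto_const tendsto_rabs idx_diff)
    moreover have "K * \<bar>s - q\<bar> < e / 3" using q K(1) by (simp add: field_simps)
    ultimately have "\<forall>\<^sub>F j in sequentially. K * \<bar>time (?m s j) - time (?m q j)\<bar> < e / 3"
      by (rule order_tendstoD(2))
    then obtain N1 where N1: "\<And>j. j \<ge> N1 \<Longrightarrow> K * \<bar>time (?m s j) - time (?m q j)\<bar> < e / 3"
      unfolding eventually_sequentially by blast
    have q_Cauchy: "Cauchy (\<lambda>j. u (?m q j))"
      using conv[of q] q s LIMSEQ_imp_Cauchy by auto
    have "e / 3 > 0" using \<open>e > 0\<close> by simp
    from metric_CauchyD[OF q_Cauchy this]
    obtain N2 where N2: "\<forall>i\<ge>N2. \<forall>j\<ge>N2. dist (u (?m q i)) (u (?m q j)) < e / 3"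
      by blast
    have near: "dist (u (?m s j)) (u (?m q j)) < e / 3" if "j \<ge> N1" for j
      using K(2)[of "?m s j" "?m q j"] N1[OF that] by (simp add: dist_norm)
    show "\<exists>N. \<forall>i\<ge>N. \<forall>j\<ge>N. dist (u (?m s i)) (u (?m s j)) < e"
    proof (intro exI allI impI)
      fix i j assume ij: "max N1 N2 \<le> i" "max N1 N2 \<le> j"
      have "dist (u (?m s i)) (u (?m s j)) \<le>
          dist (u (?m s i)) (u (?m q i)) + dist (u (?m q i)) (u (?m q j)) + dist (u (?m s j)) (u (?m q j))"
        using dist_triangle[of "u (?m s i)" "u (?m s j)" "u (?m q i)"]
          dist_triangle[of "u (?m q i)" "u (?m s j)" "u (?m q j)"] by (simp add: dist_commute)
      then show "dist (u (?m s i)) (u (?m s j)) < e"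
        using near[of i] near[of j] N2[rule_format, of i j] ij by simp
    qed
  qed
  \<comment> \<open>\<open>max 0 s\<close> continues the curve by the constant \<open>z 0\<close> to
    negative times, which makes it Lipschitz on the whole line.\<close>
  then have lim_ex: "\<exists>l. (\<lambda>j. u (?m (max 0 s) j)) \<longlonglongrightarrow> l" for s
    by (auto simp: convergent_def)
  then obtain z where z: "\<And>s. (\<lambda>j. u (?m (max 0 s) j)) \<longlonglongrightarrow> z s" by metis
  have u_lim: "(\<lambda>j. u (m j)) \<longlonglongrightarrow> z s"
    if \<sigma>: "filterlim \<sigma> at_top sequentially" and s: "0 \<le> s"
      and m: "(\<lambda>j. time (m j) - time (?n (\<sigma> j))) \<longlonglongrightarrow> s" for \<sigma> m s
  proof -
    have "(\<lambda>j. u (?m s (\<sigma> j))) \<longlonglongrightarrow> z s"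
      using filterlim_compose[OF z[of s] \<sigma>] s by (simp add: max_def)
    moreover have "(\<lambda>j. u (m j) - u (?m s (\<sigma> j))) \<longlonglongrightarrow> 0"
    proof (rule Lim_null_comparison)
      show "\<forall>\<^sub>F j in sequentially. norm (u (m j) - u (?m s (\<sigma> j))) \<le> K * \<bar>time (m j) - time (?m s (\<sigma> j))\<bar>"
        using K(2) by simp
      have "(\<lambda>j. time (m j) - time (?m s (\<sigma> j))) \<longlonglongrightarrow> 0"
        using tendsto_diff[OF m filterlim_compose[OF idx_lim[of s] \<sigma>]] by simp
      from tendsto_mult[OF tendsto_const tendsto_rabs_zero[OF this], of K]
      show "(\<lambda>j. K * \<bar>time (m j) - time (?m s (\<sigma> j))\<bar>) \<longlonglongrightarrow> 0" by simp
    qed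
    ultimately show ?thesis using tendsto_add by fastforce
  qed
  have x_lim: "(\<lambda>j. x (m j)) \<longlonglongrightarrow> z s"
    if \<sigma>: "filterlim \<sigma> at_top sequentially" and s: "0 \<le> s"
      and m: "(\<lambda>j. time (m j) - time (?n (\<sigma> j))) \<longlonglongrightarrow> s" for \<sigma> m s
  proof -
    have "filterlim (\<lambda>j. (time (m j) - time (?n (\<sigma> j))) + time (?n (\<sigma> j))) at_top sequentially"
      using m filterlim_compose[OF tn \<sigma>] by (rule filterlim_tendsto_add_at_top)
    then have "filterlim m at_top sequentially" by (intro filterlim_index) simp
    from filterlim_compose[OF close this] have "(\<lambda>j. x (m j) - u (m j)) \<longlonglongrightarrow> 0" .
    from tendsto_add[OF this u_lim[OF that]] show ?thesis by simp
  qed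
  have lip_z: "K-lipschitz_on UNIV z"
  proof (rule lipschitz_onI)
    fix s s' :: real
    have "(\<lambda>j. norm (u (?m (max 0 s) j) - u (?m (max 0 s') j))) \<longlonglongrightarrow> norm (z s - z s')"
      by (intro tendsto_intros z)
    moreover have "(\<lambda>j. K * \<bar>time (?m (max 0 s) j) - time (?m (max 0 s') j)\<bar>) \<longlonglongrightarrow> K * \<bar>max 0 s - max 0 s'\<bar>"
      by (intro tendsto_mult tendsto_const tendsto_rabs idx_diff)
    ultimately have "norm (z s - z s') \<le> K * \<bar>max 0 s - max 0 s'\<bar>"
      by (rule LIMSEQ_le) (use K(2) in auto)
    also have "\<dots> \<le> K * \<bar>s - s'\<bar>" using K(1) by (intro mult_left_mono) auto
    finally show "dist (z s) (z s') \<le> K * dist s s'" by (simp add: dist_norm)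
  qed (use K in simp)
  have traj: "subgradient_trajectory \<Omega> f z"
    unfolding subgradient_trajectory_def
  proof
    show "abs_continuous_curve z" using lip_z by (rule lipschitz_abs_continuous_curve)
    have "AE s in lebesgue. s \<notin> {s. \<not> z differentiable at s}"
      using negligible_not_differentiable_lipschitz[OF lip_z]
      by (intro AE_not_in) (simp add: negligible_iff_null_sets)
    then show "AE s in lebesgue. 0 \<le> s \<longrightarrow> (\<exists>d. (z has_vector_derivative d) (at s within {0..}) \<and>
             d \<in> uminus ` clarke_subdifferential \<Omega> f (z s))"
    proof (rule eventually_mono, intro impI)
      fix s assume "s \<notin> {s. \<not> z differentiable at s}" and s: "0 \<le> s"
      then have d: "(z has_vector_derivative vector_derivative z (at s)) (at s)"
        by (simp add: vector_derivative_works)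
      have "- vector_derivative z (at s) \<in> clarke_subdifferential \<Omega> f (z s)"
        using u_lim[of "\<lambda>j. j"] by (intro derivative_in_subdifferential[OF _ n' s d]) (auto simp: filterlim_ident)
      then show "\<exists>d. (z has_vector_derivative d) (at s within {0..}) \<and>
             d \<in> uminus ` clarke_subdifferential \<Omega> f (z s)"
        using has_vector_derivative_at_within[OF d] by (metis imageI minus_minus)
    qed
  qed
  have "continuous_on UNIV z" using lip_z by (rule lipschitz_on_continuous_on)
  moreover have "limit_curve ?n z" unfolding limit_curve_def using x_lim by blast
  ultimately show thesis by (intro that[OF r traj])
qed

end

section \<open>Convergence of values and criticality of limit points\<close>

context subgradient_recursion
begin

context
  assumes weak_Sard: "closure {r. \<not> critical_value \<Omega> f r} = UNIV"
    and descent: "\<And>z :: real \<Rightarrow> 'a. subgradient_trajectory \<Omega> f z \<Longrightarrow> \<not> critical_point \<Omega> f (z 0) \<Longrightarrow>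
       \<exists>T>0. f (z T) < (SUP t\<in>{0..T}. f (z t)) \<and> (SUP t\<in>{0..T}. f (z t)) \<le> f (z 0)"
begin

text \<open>A real \<open>SUP\<close> bounds its members only if the family is bounded above, which
  compactness of \<open>{0..T}\<close> supplies.\<close>

lemma descent_pointwise:
  assumes z: "subgradient_trajectory \<Omega> f z" "continuous_on UNIV z" "\<not> critical_point \<Omega> f (z 0)"
  obtains T where "T > 0" "f (z T) < f (z 0)" "\<And>t. 0 \<le> t \<Longrightarrow> t \<le> T \<Longrightarrow> f (z t) \<le> f (z 0)"
proof -
  obtain T where T: "T > 0" "f (z T) < (SUP t\<in>{0..T}. f (z t))" "(SUP t\<in>{0..T}. f (z t)) \<le> f (z 0)"
    using descent[OF z(1,3)] by blast
  have "continuous_on {0..T} (\<lambda>t. f (z t))"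
    by (rule continuous_on_compose2[OF continuous_f continuous_on_subset[OF z(2)]]) auto
  then have "compact ((\<lambda>t. f (z t)) ` {0..T})"
    by (intro compact_continuous_image) auto
  then have bdd: "bdd_above ((\<lambda>t. f (z t)) ` {0..T})"
    by (intro bounded_imp_bdd_above compact_imp_bounded)
  have le: "f (z t) \<le> f (z 0)" if "0 \<le> t" "t \<le> T" for t
    by (rule order_trans[OF cSUP_upper[OF _ bdd] T(3)]) (use that in simp)
  show thesis
    by (rule that[OF T(1) less_le_trans[OF T(2,3)] le])
qed

lemma tendsto_f: "(g \<longlongrightarrow> l) G \<Longrightarrow> ((\<lambda>j. f (g j)) \<longlongrightarrow> f l) G"
  using continuous_f by (rule continuous_on_tendsto_compose) auto

lemma no_upcrossing:
  assumes "p < q" and lo: "\<exists>\<^sub>F k in sequentially. f (x k) < p" and hi: "\<exists>\<^sub>F k in sequentially. q < f (x k)"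
  shows False
proof -
  \<comment> \<open>A level closer to the midpoint than half the gap lies strictly between
    \<open>p\<close> and \<open>q\<close>.\<close>
  have "\<forall>e>0. \<exists>r\<in>{r. \<not> critical_value \<Omega> f r}. dist r ((p + q) / 2) < e"
    unfolding closure_approachable[symmetric] weak_Sard by simp
  moreover have "(q - p) / 2 > 0" using \<open>p < q\<close> by simp
  ultimately have "\<exists>r\<in>{r. \<not> critical_value \<Omega> f r}. dist r ((p + q) / 2) < (q - p) / 2"
    by blast
  then obtain r where r: "\<not> critical_value \<Omega> f r" "dist r ((p + q) / 2) < (q - p) / 2"
    by blast
  have pr: "p < r" "r < q"
    using r(2) by (auto simp: dist_real_def abs_less_iff field_simps)
  have "\<exists>i e. N \<le> i \<and> i < e \<and> f (x i) \<le> r \<and> (\<forall>k. i < k \<longrightarrow> k \<le> e \<longrightarrow> r < f (x k)) \<and> q < f (x e)" for N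
  proof -
    obtain a where a: "a \<ge> N" "f (x a) < p" using lo unfolding frequently_sequentially by blast
    obtain e where e: "e \<ge> a" "q < f (x e)" using hi unfolding frequently_sequentially by blast
    txt \<open>\<open>i\<close> is the last index before \<open>e\<close> at or below level \<open>r\<close>.\<close>
    define I where "I = {k \<in> {a..e}. f (x k) \<le> r}"
    have I: "finite I" "a \<in> I" using a e pr by (auto simp: I_def)
    define i where "i = Max I"
    have "i \<in> I" using I unfolding i_def by (intro Max_in) auto
    then have i: "a \<le> i" "i \<le> e" "f (x i) \<le> r" by (auto simp: I_def)
    have "i \<noteq> e" using i e pr by auto
    moreover have "r < f (x k)" if "i < k" "k \<le> e" for k
    proof (rule ccontr)
      assume "\<not> r < f (x k)"
      then have "k \<in> I" using that i by (auto simp: I_def)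
      then have "k \<le> i" unfolding i_def using I by (intro Max_ge) auto
      with that show False by simp
    qed
    ultimately show ?thesis using a i e by (intro exI[of _ i] exI[of _ e]) auto
  qed
  then obtain n e where ne: "\<And>N. N \<le> n N" "\<And>N. n N < e N" "\<And>N. f (x (n N)) \<le> r"
      "\<And>N k. n N < k \<Longrightarrow> k \<le> e N \<Longrightarrow> r < f (x k)" "\<And>N. q < f (x (e N))"
    by metis
  have n: "filterlim n at_top sequentially"
    by (rule filterlim_at_top_mono[OF filterlim_ident]) (simp add: ne(1))
  obtain \<rho> z where \<rho>: "strict_mono \<rho>" and z: "subgradient_trajectory \<Omega> f z" "continuous_on UNIV z"
    and lc: "limit_curve (\<lambda>j. n (\<rho> j)) z"
    using limit_trajectory[OF n] by blast
  note x_lim = limit_curveD[OF lc]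
  have n': "filterlim (\<lambda>j. n (\<rho> j)) at_top sequentially"
    using n filterlim_subseq[OF \<rho>] by (rule filterlim_compose)
  have "(\<lambda>j. f (x (n (\<rho> j)))) \<longlonglongrightarrow> f (z 0)"
    by (rule tendsto_f, rule x_lim[of "\<lambda>j. j"]) (auto simp: filterlim_ident)
  then have "f (z 0) \<le> r"
    by (rule LIMSEQ_le_const2) (use ne(3) in auto)
  \<comment> \<open>The step after the exit takes a time tending to 0, so it leads to
    \<open>z 0\<close> as well, now with values above \<open>r\<close>.\<close>
  moreover have "(\<lambda>j. f (x (Suc (n (\<rho> j))))) \<longlonglongrightarrow> f (z 0)"
    using filterlim_compose[OF alpha_null n']
    by (intro tendsto_f x_lim[of "\<lambda>j. j"]) (auto simp: filterlim_ident time_Suc)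
  then have "r \<le> f (z 0)"
  proof (rule LIMSEQ_le_const, intro exI allI impI)
    show "r \<le> f (x (Suc (n (\<rho> j))))" for j
      using ne(2)[of "\<rho> j"] ne(4)[of "\<rho> j" "Suc (n (\<rho> j))"] by simp
  qed
  ultimately have z0: "f (z 0) = r" by simp
  then have "\<not> critical_point \<Omega> f (z 0)"
    using r(1) by (auto simp: critical_value_def)
  then obtain T where T: "T > 0" "f (z T) < r" "\<And>t. 0 \<le> t \<Longrightarrow> t \<le> T \<Longrightarrow> f (z t) \<le> r"
    using descent_pointwise[OF z] unfolding z0 by blast
  let ?d = "\<lambda>j. time (e (\<rho> j)) - time (n (\<rho> j))"
  show False
  proof (cases "\<exists>\<^sub>F j in sequentially. ?d j \<le> T")
    \<comment> \<open>If \<open>q\<close> is exceeded within time \<open>T\<close> infinitely often,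
      the arrival times accumulate at some \<open>s\<close>, and \<open>f (z s) >= q\<close>
      contradicts the bound \<open>r\<close> up to \<open>T\<close>.\<close>
    case True
    then obtain \<sigma> :: "nat \<Rightarrow> nat" where \<sigma>: "strict_mono \<sigma>" "\<And>j. ?d (\<sigma> j) \<le> T"
      using infinite_enumerate[of "{j. ?d j \<le> T}"]
      by (auto simp: frequently_cofinite simp flip: cofinite_eq_sequentially)
    have d_in: "?d (\<sigma> j) \<in> {0..T}" for j
      using \<sigma>(2)[of j] time_mono[of "n (\<rho> (\<sigma> j))" "e (\<rho> (\<sigma> j))"] ne(2)[of "\<rho> (\<sigma> j)"] by simp
    obtain s \<sigma>' where s: "s \<in> {0..T}" "strict_mono \<sigma>'" "((\<lambda>j. ?d (\<sigma> j)) \<circ> \<sigma>') \<longlonglongrightarrow> s"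
      using compact_Icc[of 0 T, unfolded compact_def, rule_format, of "\<lambda>j. ?d (\<sigma> j)", OF d_in] by blast
    have "filterlim (\<lambda>j. \<sigma> (\<sigma>' j)) at_top sequentially"
      using filterlim_compose[OF filterlim_subseq[OF \<sigma>(1)] filterlim_subseq[OF s(2)]] .
    then have "(\<lambda>j. x (e (\<rho> (\<sigma> (\<sigma>' j))))) \<longlonglongrightarrow> z s"
      using s by (intro x_lim) (auto simp: o_def)
    from tendsto_f[OF this] have "q \<le> f (z s)"
      by (rule LIMSEQ_le_const) (use ne(5) in \<open>auto intro: less_imp_le\<close>)
    moreover have "f (z s) \<le> r" using T(3) s(1) by simp
    ultimately show False using pr by simp
  next
    \<comment> \<open>Otherwise the iterates sampled at time \<open>T\<close> are still inside the
      upcrossing and hence above \<open>r\<close>, so \<open>f (z T)\<close> cannot lie below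
      \<open>r\<close>.\<close>
    case False
    let ?m = "\<lambda>j. idx (time (n (\<rho> j)) + T)"
    have "\<forall>\<^sub>F j in sequentially. T < ?d j"
      using False by (simp add: not_frequently not_le)
    then have "\<forall>\<^sub>F j in sequentially. r \<le> f (x (?m j))"
    proof (rule eventually_mono)
      fix j assume "T < ?d j"
      then have "?m j \<le> e (\<rho> j)" by (intro idx_le) simp
      moreover have "n (\<rho> j) < ?m j"
        using idx[of "time (n (\<rho> j)) + T"] T(1) time_mono[of "?m j" "n (\<rho> j)"]
        by (cases "n (\<rho> j) < ?m j") auto
      ultimately show "r \<le> f (x (?m j))" using ne(4) by (auto intro: less_imp_le)
    qed
    moreover have "(\<lambda>j. f (x (?m j))) \<longlonglongrightarrow> f (z T)"
      using T(1) time_idx_shift[OF n'] by (intro tendsto_f x_lim[of "\<lambda>j. j"]) (auto simp: filterlim_ident)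
    ultimately have "r \<le> f (z T)"
      by (intro tendsto_lowerbound) auto
    with T(2) show False by simp
  qed
qed

lemma convergent_values: "convergent (\<lambda>k. f (x k))"
proof -
  obtain B where B: "\<forall>k. norm (x k) \<le> B" using bounded by (auto simp: bounded_iff)
  have "compact (f ` cball 0 B)"
    by (intro compact_continuous_image continuous_on_subset[OF continuous_f]) auto
  then obtain C where C: "\<forall>v\<in>f ` cball 0 B. norm v \<le> C"
    using compact_imp_bounded bounded_iff by metis
  have "\<forall>\<^sub>F k in sequentially. \<bar>f (x k)\<bar> \<le> C"
    using B C by (intro always_eventually) auto
  then have "\<exists>l. (\<lambda>k. f (x k)) \<longlonglongrightarrow> l"
    using no_upcrossing by (intro tendsto_if_no_oscillation[of _ _ C]) auto
  then show ?thesis by (simp add: convergent_def)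
qed

lemma critical_limit_point:
  assumes "limit_point x l"
  shows "critical_point \<Omega> f l"
proof (rule ccontr)
  assume nc: "\<not> critical_point \<Omega> f l"
  obtain n where n: "strict_mono n" "(x \<circ> n) \<longlonglongrightarrow> l"
    using assms unfolding limit_point_def by blast
  have n_top: "filterlim n at_top sequentially" using n(1) by (rule filterlim_subseq)
  obtain \<rho> z where \<rho>: "strict_mono \<rho>" and z: "subgradient_trajectory \<Omega> f z" "continuous_on UNIV z"
    and lc: "limit_curve (\<lambda>j. n (\<rho> j)) z"
    using limit_trajectory[OF n_top] by blast
  note x_lim = limit_curveD[OF lc]
  have n': "filterlim (\<lambda>j. n (\<rho> j)) at_top sequentially"
    using n_top filterlim_subseq[OF \<rho>] by (rule filterlim_compose)
  have "(\<lambda>j. x (n (\<rho> j))) \<longlonglongrightarrow> z 0"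
    by (rule x_lim[of "\<lambda>j. j"]) (auto simp: filterlim_ident)
  moreover have "(\<lambda>j. x (n (\<rho> j))) \<longlonglongrightarrow> l"
    using LIMSEQ_subseq_LIMSEQ[OF n(2) \<rho>] by (simp add: o_def)
  ultimately have z0: "z 0 = l" by (rule LIMSEQ_unique)
  obtain c where c: "(\<lambda>k. f (x k)) \<longlonglongrightarrow> c"
    using convergent_values by (auto simp: convergent_def)
  \<comment> \<open>Every \<open>z s\<close> is a limit of iterates whose indices tend to infinity,
    so all these values equal the limit \<open>c\<close>.\<close>
  have const: "f (z s) = c" if "s \<ge> 0" for s
  proof -
    let ?m = "\<lambda>j. idx (time (n (\<rho> j)) + s)"
    have "(\<lambda>j. f (x (?m j))) \<longlonglongrightarrow> f (z s)"
      using that time_idx_shift[OF n'] by (intro tendsto_f x_lim[of "\<lambda>j. j"]) (auto simp: filterlim_ident)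
    moreover have "filterlim ?m at_top sequentially"
      by (rule filterlim_index, rule filterlim_at_top_mono[OF time_plus_at_top[OF n', of s]]) (simp add: idx)
    then have "(\<lambda>j. f (x (?m j))) \<longlonglongrightarrow> c" by (rule filterlim_compose[OF c])
    ultimately show ?thesis by (rule LIMSEQ_unique)
  qed
  obtain T where "T > 0" "f (z T) < f l"
    using descent_pointwise[OF z] nc unfolding z0 by blast
  then show False using const[of T] const[of 0] z0 by simp
qed

end

end

theorem theorem4p2:
  fixes f :: "'a::euclidean_space \<Rightarrow> real"
    and \<Omega> :: "'a set"
    and M :: "'w measure"
    and x y \<xi> :: "nat \<Rightarrow> 'w \<Rightarrow> 'a"
    and \<alpha> :: "nat \<Rightarrow> real"
  assumes lipschitz: "locally_lipschitz f"
    and Omega: "full_measure_differentiability_set f \<Omega>"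
    and prob: "prob_space M"
    and x_measurable: "\<And>k. k \<ge> 1 \<Longrightarrow> x k \<in> borel_measurable M"
    and y_measurable: "\<And>k. k \<ge> 1 \<Longrightarrow> y k \<in> borel_measurable M"
    and xi_measurable: "\<And>k. k \<ge> 1 \<Longrightarrow> \<xi> k \<in> borel_measurable M"
    and step: "\<And>k \<omega>. k \<ge> 1 \<Longrightarrow> \<omega> \<in> space M \<Longrightarrow>
                 x (Suc k) \<omega> = x k \<omega> - \<alpha> k *\<^sub>R (y k \<omega> + \<xi> k \<omega>)"
    and subgradient: "\<And>k \<omega>. k \<ge> 1 \<Longrightarrow> \<omega> \<in> space M \<Longrightarrow>
                        y k \<omega> \<in> clarke_subdifferential \<Omega> f (x k \<omega>)"
    and alpha_nonneg: "\<And>k. k \<ge> 1 \<Longrightarrow> \<alpha> k \<ge> 0"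
    and alpha_diverges: "filterlim (\<lambda>n. \<Sum>k=1..n. \<alpha> k) at_top sequentially"
    and alpha_square_summable: "summable (\<lambda>k. (\<alpha> (Suc k))\<^sup>2)"
    and bounded_iterates: "AE \<omega> in M. bdd_above ((\<lambda>k. norm (x k \<omega>)) ` {1..})"
    and noise: "\<exists>p :: 'a \<Rightarrow> real. (\<forall>u. p u \<ge> 0) \<and> (\<forall>B. bounded B \<longrightarrow> bounded (p ` B)) \<and>
       (AE \<omega> in M. \<forall>k\<ge>1.
          vec_cond_exp M (history M x y \<xi> k) (\<xi> k) \<omega> = 0 \<and>
          nn_cond_exp M (history M x y \<xi> k) (\<lambda>\<omega>'. ennreal ((norm (\<xi> k \<omega>'))\<^sup>2)) \<omega>
            \<le> ennreal (p (x k \<omega>)))"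
    and weak_Sard: "closure {r. \<not> critical_value \<Omega> f r} = UNIV"
    and descent: "\<And>z :: real \<Rightarrow> 'a. subgradient_trajectory \<Omega> f z \<Longrightarrow> \<not> critical_point \<Omega> f (z 0) \<Longrightarrow>
       \<exists>T>0. f (z T) < (SUP t\<in>{0..T}. f (z t)) \<and> (SUP t\<in>{0..T}. f (z t)) \<le> f (z 0)"
  shows "AE \<omega> in M. (\<forall>l. limit_point (\<lambda>k. x (Suc k) \<omega>) l \<longrightarrow> critical_point \<Omega> f l) \<and>
                    convergent (\<lambda>k. f (x (Suc k) \<omega>))"
proof -
  obtain p :: "'a \<Rightarrow> real" where p: "\<And>B. bounded B \<Longrightarrow> bounded (p ` B)"
    and noise_p: "AE \<omega> in M. \<forall>k\<ge>1.
          vec_cond_exp M (history M x y \<xi> k) (\<xi> k) \<omega> = 0 \<and>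
          nn_cond_exp M (history M x y \<xi> k) (\<lambda>\<omega>'. ennreal ((norm (\<xi> k \<omega>'))\<^sup>2)) \<omega>
            \<le> ennreal (p (x k \<omega>))"
    using noise by blast
  have "AE \<omega> in M. convergent (\<lambda>n. \<Sum>k<n. \<alpha> (Suc k) *\<^sub>R \<xi> (Suc k) \<omega>)"
    using prob x_measurable y_measurable xi_measurable alpha_square_summable bounded_iterates p noise_p
    by (rule AE_convergent_weighted_noise)
  moreover have "AE \<omega> in M. \<omega> \<in> space M" by simp
  ultimately show ?thesis using bounded_iterates
  proof eventually_elim
    case (elim \<omega>)
    define N where "N n = (\<Sum>k<n. \<alpha> (Suc k) *\<^sub>R \<xi> (Suc k) \<omega>)" for n
    obtain l where l: "N \<longlonglongrightarrow> l"
      using elim(1) by (auto simp: convergent_def N_def[abs_def])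
    \<comment> \<open>\<open>x (Suc k) \<omega>\<close> carries exactly the noise with indices 1 to
      \<open>k\<close>: adding \<open>N k\<close> removes it, and subtracting \<open>l\<close>
      brings the result back next to the iterates. The difference \<open>l - N k\<close> is the tail
      of the series.\<close>
    interpret subgradient_recursion f \<Omega> "\<lambda>k. \<alpha> (Suc k)" "\<lambda>k. x (Suc k) \<omega>"
      "\<lambda>k. x (Suc k) \<omega> + N k - l" "\<lambda>k. y (Suc k) \<omega>"
    proof
      show "locally_lipschitz f" by fact
      show "0 \<le> \<alpha> (Suc k)" for k by (rule alpha_nonneg) simp
      have "(\<lambda>k. (\<alpha> (Suc k))\<^sup>2) \<longlonglongrightarrow> 0"
        using alpha_square_summable by (rule summable_LIMSEQ_zero)
      then show "(\<lambda>k. \<alpha> (Suc k)) \<longlonglongrightarrow> 0" by simp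
      have "(\<Sum>k<n. \<alpha> (Suc k)) = (\<Sum>k=1..n. \<alpha> k)" for n
        by (simp add: sum.shift_bounds_Suc_ivl lessThan_atLeast0 atLeastLessThanSuc_atLeastAtMost
            flip: sum.shift_bounds_Suc_ivl)
      then show "filterlim (\<lambda>n. \<Sum>k<n. \<alpha> (Suc k)) at_top sequentially"
        using alpha_diverges by simp
      show "x (Suc (Suc k)) \<omega> + N (Suc k) - l = x (Suc k) \<omega> + N k - l - \<alpha> (Suc k) *\<^sub>R y (Suc k) \<omega>" for k
        using step[of "Suc k" \<omega>] elim(2) by (simp add: N_def scaleR_add_right)
      show "(\<lambda>k. x (Suc k) \<omega> - (x (Suc k) \<omega> + N k - l)) \<longlonglongrightarrow> 0"
        using tendsto_diff[OF tendsto_const[of l] l] by simp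
      show "y (Suc k) \<omega> \<in> clarke_subdifferential \<Omega> f (x (Suc k) \<omega>)" for k
        using subgradient elim(2) by simp
      obtain C where "\<And>k. k \<ge> 1 \<Longrightarrow> norm (x k \<omega>) \<le> C"
        using elim(3) by (auto simp: bdd_above_def)
      then show "bounded (range (\<lambda>k. x (Suc k) \<omega>))"
        by (auto simp: bounded_iff)
    qed
    show ?case
      using critical_limit_point[OF weak_Sard descent] convergent_values[OF weak_Sard descent] by blast
  qed
qed

end
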